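(* Let $R=\bigoplus_{\alpha\in\Gamma}R_\alpha$ be a graded integral domain. If $\star$ is a homogeneous preserving semistar operation on $R$, then the e.a.b. semistar operation $\star_a$ associated to $\star$ is also homogeneous preserving.
   Context: $\Gamma$ is a nonzero torsionless commutative cancellative monoid (written additively) with quotient group $\langle\Gamma\rangle$; $R=\bigoplus_{\alpha\in\Gamma}R_\alpha$ is an integral domain graded by $\Gamma$, with quotient field $K$; $H=\bigcup_{\alpha}(R_\alpha\setminus\{0\})$ is the set of nonzero homogeneous elements, and $R_H$ is the $\langle\Gamma\rangle$-graded localization with $(R_H)_\alpha=\{a/b\mid a\in R_\beta,\ 0\neq b\in R_\gamma,\ \beta-\gamma=\alpha\}$. An ideal $I$ of $R$ is homogeneous if $I=\bigoplus_{\alpha\in\Gamma}(I\cap R_\alpha)$; a fractional ideal $I$ of $R$ is homogeneous if $sI$ is a homogeneous integral ideal of $R$ for some $s\in H$. $\overline{\mathcal F}(R)$ is the set of nonzero $R$-submodules of $K$ and $f(R)$ the set of nonzero finitely generated fractional ideals of $R$. A semistar operation on $R$ is a map $\star:\overline{\mathcal F}(R)\to\overline{\mathcal F}(R)$, $E\mapsto E^\star$, such that for all $0\ne x\in K$ and $E,F\in\overline{\mathcal F}(R)$: $(xE)^\star=xE^\star$; $E\subseteq F\Rightarrow E^\star\subseteq F^\star$; $E\subseteq E^\star$; $(E^\star)^\star=E^\star$. It is homogeneous preserving if it sends (nonzero) homogeneous fractional ideals of $R$ to homogeneous ones, i.e. for each such $E$ one has $E^\star\subseteq R_H$ and $E^\star=\bigoplus_{\alpha\in\langle\Gamma\rangle}(E^\star\cap(R_H)_\alpha)$.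 The operation $\star_a$ is the semistar operation defined by $F^{\star_a}:=\bigcup\{((FJ)^\star:J^\star)\mid J\in f(R)\}$ for $F\in f(R)$, and $E^{\star_a}:=\bigcup\{F^{\star_a}\mid F\subseteq E,\ F\in f(R)\}$ for $E\in\overline{\mathcal F}(R)$, where $(A:B)=\{x\in K\mid xB\subseteq A\}$. *)

theory Defs
  imports "HOL-Computational_Algebra.Computational_Algebra"
begin

text \<open>
  A cancellative commutative monoid is given as a submonoid \<open>\<Gamma>\<close> of an abelian group, so that
  cancellation is automatic and the quotient group is the group of differences inside the
  ambient group (which may be larger). The sum \<open>(\<Sum>i<n. \<alpha>)\<close> is the multiple \<open>n\<alpha>\<close>.
\<close>

definition grading_monoid :: "'g::ab_group_add set \<Rightarrow> bool" where
  "grading_monoid \<Gamma> \<longleftrightarrow>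
     0 \<in> \<Gamma> \<and> (\<forall>\<alpha>\<in>\<Gamma>. \<forall>\<beta>\<in>\<Gamma>. \<alpha> + \<beta> \<in> \<Gamma>) \<and> \<Gamma> \<noteq> {0} \<and>
     (\<forall>n::nat. \<forall>\<alpha>\<in>\<Gamma>. \<forall>\<beta>\<in>\<Gamma>. n \<ge> 1 \<and> (\<Sum>i<n. \<alpha>) = (\<Sum>i<n. \<beta>) \<longrightarrow> \<alpha> = \<beta>)"

definition quotient_group :: "'g::ab_group_add set \<Rightarrow> 'g set" where
  "quotient_group \<Gamma> = {\<beta> - \<gamma> | \<beta> \<gamma>. \<beta> \<in> \<Gamma> \<and> \<gamma> \<in> \<Gamma>}"

definition additive_subgroup_of :: "'a::ab_group_add set \<Rightarrow> bool" where
  "additive_subgroup_of A \<longleftrightarrow> 0 \<in> A \<and> (\<forall>x\<in>A. \<forall>y\<in>A. x - y \<in> A)"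

definition finite_families :: "'i set \<Rightarrow> ('i \<Rightarrow> 'a::ab_group_add set) \<Rightarrow> ('i \<Rightarrow> 'a) set" where
  "finite_families I M =
     {f. (\<forall>i\<in>I. f i \<in> M i) \<and> (\<forall>i. i \<notin> I \<longrightarrow> f i = 0) \<and> finite {i. f i \<noteq> 0}}"

text \<open>\<open>A = \<Oplus>\<^sub>i M\<^sub>i\<close> as an internal direct sum: every element of \<open>A\<close> is the sum of a unique
  finitely supported family, and all such sums lie in \<open>A\<close>.\<close>

definition is_direct_sum :: "'a::ab_group_add set \<Rightarrow> 'i set \<Rightarrow> ('i \<Rightarrow> 'a set) \<Rightarrow> bool" where
  "is_direct_sum A I M \<longleftrightarrow>
     bij_betw (\<lambda>f. \<Sum>i | f i \<noteq> 0. f i) (finite_families I M) A"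

text \<open>The domain \<open>R\<close> is a whole type \<open>'r\<close>, its quotient field \<open>K\<close> is \<open>'r fract\<close>, and the
  homogeneous component of degree \<open>\<alpha>\<close> is \<open>Rc \<alpha>\<close> (only its values on \<open>\<Gamma>\<close> matter).\<close>

definition graded_domain :: "'g::ab_group_add set \<Rightarrow> ('g \<Rightarrow> 'r::idom set) \<Rightarrow> bool" where
  "graded_domain \<Gamma> Rc \<longleftrightarrow>
     (\<forall>\<alpha>\<in>\<Gamma>. additive_subgroup_of (Rc \<alpha>)) \<and>
     is_direct_sum (UNIV :: 'r set) \<Gamma> Rc \<and>
     (\<forall>\<alpha>\<in>\<Gamma>. \<forall>\<beta>\<in>\<Gamma>. \<forall>x\<in>Rc \<alpha>. \<forall>y\<in>Rc \<beta>. x * y \<in> Rc (\<alpha> + \<beta>))"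

definition homogeneous_elements :: "'g::ab_group_add set \<Rightarrow> ('g \<Rightarrow> 'r::idom set) \<Rightarrow> 'r set" where
  "homogeneous_elements \<Gamma> Rc = (\<Union>\<alpha>\<in>\<Gamma>. Rc \<alpha> - {0})"

definition homogeneous_localization ::
    "'g::ab_group_add set \<Rightarrow> ('g \<Rightarrow> 'r::idom set) \<Rightarrow> 'r fract set" where
  "homogeneous_localization \<Gamma> Rc = {Fract a b | a b. b \<in> homogeneous_elements \<Gamma> Rc}"

text \<open>Zero is adjoined because there may be no suitable fraction at all, for instance in
  degree \<open>-1\<close> for \<open>\<Gamma> = \<nat>\<close> and \<open>R = R\<^sub>0\<close>; the component is then the zero group.\<close>

definition localization_component ::
    "'g::ab_group_add set \<Rightarrow> ('g \<Rightarrow> 'r::idom set) \<Rightarrow> 'g \<Rightarrow> 'r fract set" where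
  "localization_component \<Gamma> Rc \<alpha> =
     insert 0 {Fract a b | a b \<beta> \<gamma>. \<beta> \<in> \<Gamma> \<and> \<gamma> \<in> \<Gamma> \<and> a \<in> Rc \<beta> \<and> b \<in> Rc \<gamma> \<and> b \<noteq> 0 \<and> \<beta> - \<gamma> = \<alpha>}"

definition fract_scale :: "'r::idom \<Rightarrow> 'r fract \<Rightarrow> 'r fract" where
  "fract_scale r x = to_fract r * x"

global_interpretation fract: module "fract_scale :: 'r::idom \<Rightarrow> 'r fract \<Rightarrow> 'r fract"
  by unfold_locales (simp_all add: fract_scale_def algebra_simps)

definition ring_ideal :: "'r::idom set \<Rightarrow> bool" where
  "ring_ideal I \<longleftrightarrow> module.subspace (*) I"

definition nonzero_submodules :: "'r::idom fract set set" where
  "nonzero_submodules = {E. fract.subspace E \<and> E \<noteq> {0}}"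

definition fractional_ideal :: "'r::idom fract set \<Rightarrow> bool" where
  "fractional_ideal E \<longleftrightarrow>
     fract.subspace E \<and> (\<exists>s. s \<noteq> 0 \<and> fract_scale s ` E \<subseteq> range to_fract)"

definition fg_fractional_ideals :: "'r::idom fract set set" where
  "fg_fractional_ideals =
     {E. fractional_ideal E \<and> E \<noteq> {0} \<and> (\<exists>B. finite B \<and> E = fract.span B)}"

definition module_product :: "'r::idom fract set \<Rightarrow> 'r fract set \<Rightarrow> 'r fract set" where
  "module_product E F = fract.span {x * y | x y. x \<in> E \<and> y \<in> F}"

definition module_colon :: "'r::idom fract set \<Rightarrow> 'r fract set \<Rightarrow> 'r fract set" where
  "module_colon A B = {x. (*) x ` B \<subseteq> A}"

definition homogeneous_ideal ::
    "'g::ab_group_add set \<Rightarrow> ('g \<Rightarrow> 'r::idom set) \<Rightarrow> 'r set \<Rightarrow> bool" where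
  "homogeneous_ideal \<Gamma> Rc I \<longleftrightarrow> ring_ideal I \<and> is_direct_sum I \<Gamma> (\<lambda>\<alpha>. I \<inter> Rc \<alpha>)"

definition homogeneous_fractional_ideal ::
    "'g::ab_group_add set \<Rightarrow> ('g \<Rightarrow> 'r::idom set) \<Rightarrow> 'r fract set \<Rightarrow> bool" where
  "homogeneous_fractional_ideal \<Gamma> Rc E \<longleftrightarrow>
     fractional_ideal E \<and>
     (\<exists>s\<in>homogeneous_elements \<Gamma> Rc. \<exists>I. homogeneous_ideal \<Gamma> Rc I \<and>
        fract_scale s ` E = to_fract ` I)"

text \<open>A semistar operation is a function on all subsets of \<open>K\<close> of which only the values on
  nonzero submodules are relevant.\<close>

definition semistar_operation :: "('r::idom fract set \<Rightarrow> 'r fract set) \<Rightarrow> bool" where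
  "semistar_operation star \<longleftrightarrow>
     (\<forall>E\<in>nonzero_submodules. star E \<in> nonzero_submodules) \<and>
     (\<forall>x. \<forall>E\<in>nonzero_submodules. x \<noteq> 0 \<longrightarrow> star ((*) x ` E) = (*) x ` star E) \<and>
     (\<forall>E\<in>nonzero_submodules. \<forall>F\<in>nonzero_submodules. E \<subseteq> F \<longrightarrow> star E \<subseteq> star F) \<and>
     (\<forall>E\<in>nonzero_submodules. E \<subseteq> star E) \<and>
     (\<forall>E\<in>nonzero_submodules. star (star E) = star E)"

definition homogeneous_preserving ::
    "'g::ab_group_add set \<Rightarrow> ('g \<Rightarrow> 'r::idom set) \<Rightarrow> ('r fract set \<Rightarrow> 'r fract set) \<Rightarrow> bool" where
  "homogeneous_preserving \<Gamma> Rc star \<longleftrightarrow>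
     (\<forall>E. homogeneous_fractional_ideal \<Gamma> Rc E \<and> E \<noteq> {0} \<longrightarrow>
        star E \<subseteq> homogeneous_localization \<Gamma> Rc \<and>
        is_direct_sum (star E) (quotient_group \<Gamma>)
          (\<lambda>\<alpha>. star E \<inter> localization_component \<Gamma> Rc \<alpha>))"

definition star_a_fg :: "('r::idom fract set \<Rightarrow> 'r fract set) \<Rightarrow> 'r fract set \<Rightarrow> 'r fract set" where
  "star_a_fg star F = (\<Union>J\<in>fg_fractional_ideals. module_colon (star (module_product F J)) (star J))"

definition star_a :: "('r::idom fract set \<Rightarrow> 'r fract set) \<Rightarrow> 'r fract set \<Rightarrow> 'r fract set" where
  "star_a star E = (\<Union>F\<in>{F \<in> fg_fractional_ideals. F \<subseteq> E}. star_a_fg star F)"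

text \<open>On finitely generated fractional ideals the two formulas agree, so \<open>star_a\<close> needs no
  case distinction.\<close>

lemma module_product_nonzero:
  assumes "F \<in> fg_fractional_ideals" "J \<in> fg_fractional_ideals"
  shows "module_product F J \<in> nonzero_submodules"
proof -
  have "\<exists>x\<in>E. x \<noteq> 0" if "E \<in> fg_fractional_ideals" for E :: "'a fract set"
  proof -
    have "fract.subspace E" "E \<noteq> {0}"
      using that unfolding fg_fractional_ideals_def fractional_ideal_def by blast+
    then show ?thesis
      using fract.subspace_0[of E] by blast
  qed
  then obtain x y where xy: "x \<in> F" "x \<noteq> 0" "y \<in> J" "y \<noteq> 0"
    using assms by blast
  have "x * y \<in> module_product F J"
    unfolding module_product_def by (rule fract.span_base) (use xy in blast)
  moreover have "x * y \<noteq> 0"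
    using xy by simp
  ultimately have "module_product F J \<noteq> {0}"
    by blast
  moreover have "fract.subspace (module_product F J)"
    unfolding module_product_def by (rule fract.subspace_span)
  ultimately show ?thesis
    unfolding nonzero_submodules_def by blast
qed

lemma star_a_eq_star_a_fg:
  assumes "semistar_operation star" "F \<in> fg_fractional_ideals"
  shows "star_a star F = star_a_fg star F"
proof
  show "star_a_fg star F \<subseteq> star_a star F"
    using assms(2) unfolding star_a_def by blast
  show "star_a star F \<subseteq> star_a_fg star F"
  proof
    fix x assume "x \<in> star_a star F"
    then obtain G J where G: "G \<in> fg_fractional_ideals" "G \<subseteq> F"
      and J: "J \<in> fg_fractional_ideals"
      and x: "x \<in> module_colon (star (module_product G J)) (star J)"
      unfolding star_a_def star_a_fg_def by blast
    have "module_product G J \<subseteq> module_product F J"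
      unfolding module_product_def by (rule fract.span_mono) (use G in blast)
    then have "star (module_product G J) \<subseteq> star (module_product F J)"
      using assms(1) module_product_nonzero[OF G(1) J] module_product_nonzero[OF assms(2) J]
      unfolding semistar_operation_def by blast
    with x have "x \<in> module_colon (star (module_product F J)) (star J)"
      unfolding module_colon_def by blast
    with J show "x \<in> star_a_fg star F"
      unfolding star_a_fg_def by blast
  qed
qed

end

theory Submission
  imports Defs "HOL-Library.Poly_Mapping" "HOL-Library.Set_Algebras" "HOL-Library.FuncSet"
begin

text \<open>
  Let \<open>E\<close> be homogeneous and \<open>x J \<subseteq> (F J)\<^sup>\<star>\<close> with \<open>F \<subseteq> E\<close> and \<open>J\<close> finitely generated. Whenever
  \<open>z J \<subseteq> R\<^sub>H\<close>, also \<open>z F J\<close> lies in a finitely generated homogeneous fractional ideal, so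
  \<open>z x J \<subseteq> (z F J)\<^sup>\<star> \<subseteq> R\<^sub>H\<close>. Hence \<open>x\<^sup>n J \<subseteq> R\<^sub>H\<close> for all \<open>n\<close>, and \<open>x \<in> R\<^sub>H\<close> because \<open>R\<^sub>H\<close> is completely
  integrally closed. Let \<open>P\<close> be generated by the homogeneous components of generators of \<open>J\<close>, and
  \<open>F'\<close> by those of generators of \<open>F\<close>. Then \<open>(F' P)\<^sup>\<star>\<close> is homogeneous and contains \<open>x J\<close>, so it contains the
  components of \<open>x a\<close> for all generators \<open>a\<close> of \<open>J\<close>. By a Dedekind--Mertens argument, each component of \<open>x\<close>
  multiplies \<open>P\<^bsup>n+1\<^esup>\<close> into \<open>(F' P\<^bsup>n+1\<^esup>)\<^sup>\<star>\<close> when \<open>n\<close> is large, and therefore lies in the \<open>\<star>\<^sub>a\<close>-closure of \<open>E\<close>.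
\<close>

section \<open>Torsion-free abelian groups\<close>

text \<open>As \<open>J\<close> is not homogeneous,
  \<open>x J \<subseteq> (F J)\<^sup>\<star>\<close> gives no direct information on single
  components of \<open>x\<close>: a component of \<open>x a\<close> mixes several of them.
  Dedekind--Mertens separates them at the price of extra factors from \<open>P\<close>, and the
  definition of \<open>\<star>\<^sub>a\<close> absorbs this price, because any finitely generated
  module may serve as \<open>J\<close>; here \<open>P ^ Suc n\<close> does. Components exist only
  inside \<open>R\<^sub>H\<close>, so \<open>x \<in> R\<^sub>H\<close> has to be known beforehand.
  The grading monoid carries no order. The degrees occurring in one argument lie in a finitely
  generated, hence free, subgroup, and an embedding into integer vectors supplies both a
  lexicographic order, for leading terms, and integer coordinates. The order alone would not stop
  the division by leading terms, since in rank at least 2 there are infinite descending chains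
  between two fixed vectors; the coordinates confine the degrees to a finite box.\<close>

definition zmul :: "int \<Rightarrow> 'a::ab_group_add \<Rightarrow> 'a" where
  "zmul m a = (\<Sum>i<nat m. a) - (\<Sum>i<nat (- m). a)"

lemma zmul_0 [simp]: "zmul 0 a = 0"
  by (simp add: zmul_def)

lemma zmul_plus1: "zmul (m + 1) a = zmul m a + a"
proof (cases "m \<ge> 0")
  case True
  then have "nat (m + 1) = Suc (nat m)" "nat (- m) = 0" "nat (- 1 - m) = 0" by auto
  then show ?thesis by (simp add: zmul_def)
next
  case False
  then have "nat (- m) = Suc (nat (- (m + 1)))" "nat (m + 1) = 0" "nat m = 0" by auto
  then show ?thesis by (simp add: zmul_def del: minus_add_distrib)
qed

lemma zmul_minus1: "zmul (m - 1) a = zmul m a - a"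
  using zmul_plus1[of "m - 1" a] by simp

lemma zmul_1 [simp]: "zmul 1 a = a"
  using zmul_plus1[of 0 a] by simp

lemma zmul_add_left: "zmul (m + n) a = zmul m a + zmul n a"
proof (induction n rule: int_induct[where k = 0])
  case (step1 i)
  then show ?case
    using zmul_plus1[of "m + i" a] zmul_plus1[of i a] by (simp add: ac_simps)
next
  case (step2 i)
  then show ?case
    using zmul_minus1[of "m + i" a] zmul_minus1[of i a] by (simp add: add_diff_eq)
qed simp

lemma zmul_minus_left: "zmul (- m) a = - zmul m a"
  by (simp add: zmul_def)

lemma zmul_diff_left: "zmul (m - n) a = zmul m a - zmul n a"
  using zmul_add_left[of m "- n" a] by (simp add: zmul_minus_left)

lemma zmul_add_right: "zmul m (a + b) = zmul m a + zmul m b"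
  by (simp add: zmul_def sum.distrib)

lemma zmul_diff_right: "zmul m (a - b) = zmul m a - zmul m b"
  by (simp add: zmul_def sum_subtractf)

lemma zmul_0_right [simp]: "zmul m 0 = 0"
  by (simp add: zmul_def)

lemma zmul_commute: "zmul m (zmul n a) = zmul n (zmul m a)"
  by (induction n rule: int_induct[where k = 0])
    (simp_all add: zmul_plus1 zmul_minus1 zmul_add_right zmul_diff_right)

section \<open>Subgroups and torsion-freeness relative to a subset\<close>

lemma additive_subgroup_of_uminus: "additive_subgroup_of A \<Longrightarrow> x \<in> A \<Longrightarrow> - x \<in> A"
  unfolding additive_subgroup_of_def by (metis diff_0)

lemma additive_subgroup_of_add: "additive_subgroup_of A \<Longrightarrow> x \<in> A \<Longrightarrow> y \<in> A \<Longrightarrow> x + y \<in> A"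
  using additive_subgroup_of_uminus[of A y] unfolding additive_subgroup_of_def
  by (metis diff_minus_eq_add)

lemma additive_subgroup_of_diff: "additive_subgroup_of A \<Longrightarrow> x \<in> A \<Longrightarrow> y \<in> A \<Longrightarrow> x - y \<in> A"
  by (simp add: additive_subgroup_of_def)

lemma additive_subgroup_of_0: "additive_subgroup_of A \<Longrightarrow> 0 \<in> A"
  by (simp add: additive_subgroup_of_def)

lemma additive_subgroup_of_zmul:
  assumes "additive_subgroup_of A" "x \<in> A"
  shows "zmul m x \<in> A"
  by (induction m rule: int_induct[where k = 0])
    (use assms in \<open>auto simp: zmul_plus1 zmul_minus1 additive_subgroup_of_0
      additive_subgroup_of_diff additive_subgroup_of_add\<close>)

lemma additive_subgroup_of_sum:
  assumes "additive_subgroup_of A" "\<And>i. i \<in> S \<Longrightarrow> f i \<in> A"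
  shows "sum f S \<in> A"
  using assms(2)
  by (induction S rule: infinite_finite_induct)
    (auto simp: additive_subgroup_of_0 additive_subgroup_of_add assms(1))

text \<open>Relative to a subset, because only the quotient group of the grading monoid is known to
  be torsion-free, while the ambient type may have torsion. Multiples are written as finite sums to
  match \<open>grading_monoid\<close>.\<close>

definition torsion_free :: "'a::ab_group_add set \<Rightarrow> bool" where
  "torsion_free A \<longleftrightarrow> (\<forall>n::nat. \<forall>a\<in>A. n \<ge> 1 \<and> (\<Sum>i<n. a) = 0 \<longrightarrow> a = 0)"

lemma torsion_free_zmul:
  assumes "torsion_free A" "a \<in> A" "m \<noteq> 0" "zmul m a = 0"
  shows "a = 0"
proof (cases "m > 0")
  case True
  then have "nat m \<ge> 1" "(\<Sum>i<nat m. a) = 0" using assms by (auto simp: zmul_def)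
  then show ?thesis using assms(1,2) unfolding torsion_free_def by blast
next
  case False
  then have "nat (- m) \<ge> 1" "(\<Sum>i<nat (- m). a) = 0" using assms by (auto simp: zmul_def)
  then show ?thesis using assms(1,2) unfolding torsion_free_def by blast
qed

definition additive_on :: "'a::plus set \<Rightarrow> ('a \<Rightarrow> 'b::plus) \<Rightarrow> bool" where
  "additive_on A \<phi> \<longleftrightarrow> (\<forall>x\<in>A. \<forall>y\<in>A. \<phi> (x + y) = \<phi> x + \<phi> y)"

lemma additive_on_diff:
  fixes \<phi> :: "'a::ab_group_add \<Rightarrow> 'b::ab_group_add"
  assumes "additive_subgroup_of A" "additive_on A \<phi>" "x \<in> A" "y \<in> A"
  shows "\<phi> (x - y) = \<phi> x - \<phi> y"
proof -
  have "\<phi> (x - y + y) = \<phi> (x - y) + \<phi> y"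
    using assms unfolding additive_on_def by (metis additive_subgroup_of_diff)
  then show ?thesis by simp
qed

section \<open>Embedding into integer vectors, and unique products\<close>

lemma adjoin_subgroup:
  assumes A: "additive_subgroup_of A"
  shows "additive_subgroup_of {y. \<exists>m. y - zmul m g \<in> A}"
  unfolding additive_subgroup_of_def
proof (intro conjI ballI)
  show "0 \<in> {y. \<exists>m. y - zmul m g \<in> A}"
    using additive_subgroup_of_0[OF A] by (auto intro!: exI[of _ 0])
  fix x y assume "x \<in> {y. \<exists>m. y - zmul m g \<in> A}" "y \<in> {y. \<exists>m. y - zmul m g \<in> A}"
  then obtain m n where "x - zmul m g \<in> A" "y - zmul n g \<in> A" by blast
  from additive_subgroup_of_diff[OF A this]
  have "(x - y) - zmul (m - n) g \<in> A" by (simp add: zmul_diff_left algebra_simps)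
  then show "x - y \<in> {y. \<exists>m. y - zmul m g \<in> A}" by blast
qed

text \<open>Generators are adjoined one at a time. The target type is chosen because it is a
  lexicographically ordered group and also has integer coordinates.\<close>

lemma embed_finitely_generated_torsion_free:
  fixes G :: "'a::ab_group_add set"
  assumes "finite X" "X \<subseteq> G" and G: "additive_subgroup_of G" "torsion_free G"
  obtains A r and \<psi> :: "'a \<Rightarrow> (nat \<Rightarrow>\<^sub>0 int)"
  where "additive_subgroup_of A" "X \<subseteq> A" "A \<subseteq> G" "additive_on A \<psi>" "inj_on \<psi> A"
    "\<And>a. a \<in> A \<Longrightarrow> Poly_Mapping.keys (\<psi> a) \<subseteq> {..<r}"
proof -
  have "\<exists>A r (\<psi> :: 'a \<Rightarrow> (nat \<Rightarrow>\<^sub>0 int)). additive_subgroup_of A \<and> X \<subseteq> A \<and> A \<subseteq> G \<and>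
    additive_on A \<psi> \<and> inj_on \<psi> A \<and> (\<forall>a\<in>A. Poly_Mapping.keys (\<psi> a) \<subseteq> {..<r})"
    using assms(1,2)
  proof (induction X)
    case empty
    have "additive_subgroup_of {0::'a}" by (simp add: additive_subgroup_of_def)
    moreover have "additive_on {0::'a} (\<lambda>_. 0::nat \<Rightarrow>\<^sub>0 int)" by (simp add: additive_on_def)
    ultimately show ?case using additive_subgroup_of_0[OF G(1)]
      by (intro exI[of _ "{0}"] exI[of _ 0] exI[of _ "\<lambda>_. 0"]) auto
  next
    case (insert g X)
    then obtain A r and \<psi> :: "'a \<Rightarrow> (nat \<Rightarrow>\<^sub>0 int)" where A: "additive_subgroup_of A"
      and XA: "X \<subseteq> A" "A \<subseteq> G" and \<psi>: "additive_on A \<psi>" "inj_on \<psi> A"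
      and keys: "\<And>a. a \<in> A \<Longrightarrow> Poly_Mapping.keys (\<psi> a) \<subseteq> {..<r}" by blast
    have g: "g \<in> G" using insert by simp
    define A' where "A' = {y. \<exists>m. y - zmul m g \<in> A}"
    have A': "additive_subgroup_of A'" unfolding A'_def by (rule adjoin_subgroup[OF A])
    have "insert g X \<subseteq> A'"
    proof
      fix y assume "y \<in> insert g X"
      then have "y - zmul 1 g \<in> A \<or> y - zmul 0 g \<in> A"
        using additive_subgroup_of_0[OF A] XA by auto
      then show "y \<in> A'" unfolding A'_def by blast
    qed
    moreover have A'G: "A' \<subseteq> G"
    proof
      fix y assume "y \<in> A'"
      then obtain m where "y - zmul m g \<in> G" unfolding A'_def using XA by blast
      from additive_subgroup_of_add[OF G(1) this additive_subgroup_of_zmul[OF G(1) g, of m]]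
      show "y \<in> G" by simp
    qed
    \<comment> \<open>If a nonzero multiple of \<open>g\<close> lies in \<open>A\<close>, say the
      \<open>N\<close>-fold one, then multiplication by \<open>N\<close> embeds \<open>A'\<close>
      into \<open>A\<close>. Otherwise \<open>A'\<close> is the direct sum of \<open>A\<close> and
      the infinite cyclic group of \<open>g\<close>, which gets a new coordinate.\<close>
    moreover have "\<exists>r (\<psi> :: 'a \<Rightarrow> (nat \<Rightarrow>\<^sub>0 int)). additive_on A' \<psi> \<and> inj_on \<psi> A' \<and>
      (\<forall>a\<in>A'. Poly_Mapping.keys (\<psi> a) \<subseteq> {..<r})"
    proof (cases "\<exists>N. N \<noteq> 0 \<and> zmul N g \<in> A")
      case True
      then obtain N where N: "N \<noteq> 0" "zmul N g \<in> A" by blast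
      have NA: "zmul N y \<in> A" if y: "y \<in> A'" for y
      proof -
        from y obtain m where m: "y - zmul m g \<in> A" unfolding A'_def by blast
        have "zmul N (y - zmul m g) + zmul m (zmul N g) \<in> A"
          by (intro additive_subgroup_of_add additive_subgroup_of_zmul A m N)
        then show ?thesis by (simp add: zmul_diff_right zmul_commute[of m N])
      qed
      have "additive_on A' (\<lambda>y. \<psi> (zmul N y))"
        using \<psi>(1) NA unfolding additive_on_def by (simp add: zmul_add_right)
      moreover have "inj_on (\<lambda>y. \<psi> (zmul N y)) A'"
      proof
        fix y z assume yz: "y \<in> A'" "z \<in> A'" and eq: "\<psi> (zmul N y) = \<psi> (zmul N z)"
        from eq have "zmul N y = zmul N z" using \<psi>(2) NA yz by (meson inj_onD)
        then have "zmul N (y - z) = 0" by (simp add: zmul_diff_right)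
        moreover have "y - z \<in> G" using yz A'G additive_subgroup_of_diff[OF G(1)] by blast
        ultimately show "y = z" using torsion_free_zmul[OF G(2)] N(1) by fastforce
      qed
      ultimately show ?thesis using keys NA
        by (intro exI[of _ r] exI[of _ "\<lambda>y. \<psi> (zmul N y)"]) blast
    next
      case False
      define c where "c y = (SOME m. y - zmul m g \<in> A)" for y
      have c: "y - zmul (c y) g \<in> A" if "y \<in> A'" for y
        using that unfolding A'_def c_def by (auto intro: someI)
      have c_unique: "m = c y" if "y - zmul m g \<in> A" for m y
      proof (rule ccontr)
        assume "m \<noteq> c y"
        have "y \<in> A'" using that unfolding A'_def by blast
        from additive_subgroup_of_diff[OF A that c[OF this]]
        have "zmul (c y - m) g \<in> A" by (simp add: zmul_diff_left)
        then show False using False \<open>m \<noteq> c y\<close> by (metis right_minus_eq)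
      qed
      \<comment> \<open>On \<open>A\<close> the keys of \<open>\<psi>\<close> are below
        \<open>r\<close>, so position \<open>r\<close> is free to record the coefficient
        \<open>c y\<close> of \<open>g\<close>.\<close>
      define \<psi>' where "\<psi>' y = \<psi> (y - zmul (c y) g) + Poly_Mapping.single r (c y)" for y
      have "additive_on A' \<psi>'"
        unfolding additive_on_def
      proof (intro ballI)
        fix y z assume yz: "y \<in> A'" "z \<in> A'"
        have *: "(y - zmul (c y) g) + (z - zmul (c z) g) = (y + z) - zmul (c y + c z) g"
          by (simp add: zmul_add_left)
        have "c y + c z = c (y + z)"
          using additive_subgroup_of_add[OF A c[OF yz(1)] c[OF yz(2)]]
          by (intro c_unique) (simp only: *)
        moreover have "\<psi> ((y - zmul (c y) g) + (z - zmul (c z) g))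
            = \<psi> (y - zmul (c y) g) + \<psi> (z - zmul (c z) g)"
          using \<psi>(1) c yz unfolding additive_on_def by blast
        ultimately show "\<psi>' (y + z) = \<psi>' y + \<psi>' z"
          unfolding \<psi>'_def * by (simp add: single_add flip: \<open>c y + c z = _\<close>)
      qed
      moreover have look: "Poly_Mapping.lookup (\<psi> (y - zmul (c y) g)) r = 0" if "y \<in> A'" for y
        using keys[OF c[OF that]] by (auto simp: in_keys_iff)
      moreover have "inj_on \<psi>' A'"
      proof
        fix y z assume yz: "y \<in> A'" "z \<in> A'" and eq: "\<psi>' y = \<psi>' z"
        from arg_cong[OF eq, of "\<lambda>p. Poly_Mapping.lookup p r"]
        have cc: "c y = c z" using look yz by (simp add: \<psi>'_def lookup_add)
        with eq have "\<psi> (y - zmul (c y) g) = \<psi> (z - zmul (c z) g)" by (simp add: \<psi>'_def)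
        then have "y - zmul (c y) g = z - zmul (c z) g" using \<psi>(2) c yz by (meson inj_onD)
        then show "y = z" using cc by simp
      qed
      moreover have "Poly_Mapping.keys (\<psi>' y) \<subseteq> {..<Suc r}" if "y \<in> A'" for y
      proof -
        have "Poly_Mapping.keys (\<psi>' y) \<subseteq> Poly_Mapping.keys (\<psi> (y - zmul (c y) g)) \<union> {r}"
          unfolding \<psi>'_def using Poly_Mapping.keys_add
          by (metis (no_types, opaque_lifting) Un_mono dual_order.refl empty_subsetI keys_single subset_trans)
        then show ?thesis using keys[OF c[OF that]] by force
      qed
      ultimately show ?thesis by blast
    qed
    ultimately show ?case using A' by blast
  qed
  then show ?thesis using that by blast
qed

text \<open>The maxima of \<open>X\<close> and \<open>Y\<close> in the order pulled back along the
  embedding have this property: two summands bounded by the maxima reach their sum only if both are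
  maximal.\<close>

lemma unique_product:
  fixes G :: "'a::ab_group_add set"
  assumes G: "additive_subgroup_of G" "torsion_free G"
    and "finite X" "X \<noteq> {}" "X \<subseteq> G" "finite Y" "Y \<noteq> {}" "Y \<subseteq> G"
  obtains a b where "a \<in> X" "b \<in> Y"
    "\<And>a' b'. a' \<in> X \<Longrightarrow> b' \<in> Y \<Longrightarrow> a' + b' = a + b \<Longrightarrow> a' = a \<and> b' = b"
proof -
  obtain A r and \<psi> :: "'a \<Rightarrow> (nat \<Rightarrow>\<^sub>0 int)" where A: "X \<union> Y \<subseteq> A"
    "additive_on A \<psi>" "inj_on \<psi> A"
    using embed_finitely_generated_torsion_free[of "X \<union> Y" G] assms by (metis Un_least finite_UnI)
  have "Max (\<psi> ` X) \<in> \<psi> ` X" "Max (\<psi> ` Y) \<in> \<psi> ` Y" using assms by auto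
  then obtain a b where ab: "a \<in> X" "b \<in> Y" "\<psi> a = Max (\<psi> ` X)" "\<psi> b = Max (\<psi> ` Y)" by auto
  have "a' = a \<and> b' = b" if "a' \<in> X" "b' \<in> Y" "a' + b' = a + b" for a' b'
  proof -
    have le: "\<psi> a' \<le> \<psi> a" "\<psi> b' \<le> \<psi> b" using that ab assms by auto
    have "\<psi> a' + \<psi> b' = \<psi> a + \<psi> b"
      using A that ab unfolding additive_on_def by (metis UnCI subsetD)
    with le have "\<psi> a' = \<psi> a" "\<psi> b' = \<psi> b"
      by (metis add_le_cancel_right add_left_mono order_antisym, metis add_le_cancel_left add_right_mono order_antisym)
    then show ?thesis using A that ab by (metis UnCI inj_onD subsetD)
  qed
  then show ?thesis using that ab by blast
qed

section \<open>Products of sets\<close>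

text \<open>\<open>P ^ n\<close> is the set of products of \<open>n\<close> elements of
  \<open>P\<close>. Either \<open>f\<close> can be pulled out of a product, or all its factors lie
  in \<open>Q\<close>.\<close>

lemma power_Suc_insert_cases:
  fixes f :: "'b::comm_monoid_mult"
  assumes "P \<subseteq> insert f Q" "p \<in> P ^ Suc n"
  shows "p \<in> Q ^ Suc n \<or> (\<exists>q \<in> P ^ n. p = f * q)"
  using assms(2)
proof (induction n arbitrary: p)
  case 0
  then have "p \<in> P" "P ^ Suc 0 = P" "Q ^ Suc 0 = Q"
    by (simp_all only: power_Suc power_0 mult_1_right)
  then show ?case using assms(1) by auto
next
  case (Suc n)
  then obtain a q where p: "p = a * q" "a \<in> P" "q \<in> P ^ Suc n"
    unfolding power_Suc[of _ "Suc n"] by (blast elim: set_times_elim)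
  show ?case
  proof (cases "a = f")
    case True
    then show ?thesis using p by blast
  next
    case False
    then have a: "a \<in> Q" using p assms(1) by blast
    from Suc.IH[OF p(3)] show ?thesis
    proof
      assume "q \<in> Q ^ Suc n"
      then have "p \<in> Q ^ Suc (Suc n)" unfolding power_Suc[of _ "Suc n"] p(1)
        using a by (rule set_times_intro[rotated])
      then show ?thesis by blast
    next
      assume "\<exists>q' \<in> P ^ n. q = f * q'"
      then obtain q' where "q' \<in> P ^ n" "q = f * q'" by blast
      moreover from this have "a * q' \<in> P ^ Suc n" using p(2) by (auto intro: set_times_intro)
      ultimately show ?thesis using p(1) by (metis mult.left_commute)
    qed
  qed
qed

lemma power_set_mono: "P \<subseteq> Q \<Longrightarrow> P ^ n \<subseteq> (Q :: 'b::comm_monoid_mult set) ^ n"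
  by (induction n) (simp_all only: power_0 power_Suc order_refl set_times_mono2)

lemma finite_set_power:
  fixes P :: "'b::comm_monoid_mult set"
  assumes "finite P"
  shows "finite (P ^ n)"
  by (induction n) (use assms in \<open>auto simp: finite_set_times\<close>)

text \<open>\<open>\<not> A \<subseteq> {0}\<close> says that \<open>A\<close> spans a nonzero
  module, and the semistar axioms speak only of such modules.\<close>

lemma set_times_nonzero:
  fixes A B :: "'a::idom set"
  assumes "\<not> A \<subseteq> {0}" "\<not> B \<subseteq> {0}"
  shows "\<not> A * B \<subseteq> {0}"
proof -
  obtain a b where "a \<in> A" "a \<noteq> 0" "b \<in> B" "b \<noteq> 0" using assms by blast
  then have "a * b \<in> A * B" "a * b \<noteq> 0" by auto
  then show ?thesis by blast
qed

lemma set_power_nonzero: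
  fixes A :: "'a::idom set"
  assumes "\<not> A \<subseteq> {0}"
  shows "\<not> A ^ n \<subseteq> {0}"
proof (induction n)
  case 0
  have "(1::'a) \<in> 1" by simp
  then show ?case unfolding power_0 by auto
qed (simp only: power_Suc set_times_nonzero assms not_False_eq_True)

section \<open>Graded fields\<close>

text \<open>The model is \<open>R\<^sub>H\<close> inside its field of fractions: nonzero homogeneous
  elements are units. The field itself carries no grading; the graded ring is the sum
  \<open>T\<close> of the components.\<close>

locale graded_field =
  fixes G :: "'g::ab_group_add set" and C :: "'g \<Rightarrow> 'k::field set"
  assumes subgroup_G: "additive_subgroup_of G"
    and torsion_free_G: "torsion_free G"
    and C_subgroup: "\<alpha> \<in> G \<Longrightarrow> additive_subgroup_of (C \<alpha>)"
    and C_mult: "\<alpha> \<in> G \<Longrightarrow> \<beta> \<in> G \<Longrightarrow> x \<in> C \<alpha> \<Longrightarrow> y \<in> C \<beta> \<Longrightarrow> x * y \<in> C (\<alpha> + \<beta>)"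
    and C_inverse: "\<alpha> \<in> G \<Longrightarrow> x \<in> C \<alpha> \<Longrightarrow> inverse x \<in> C (- \<alpha>)"
    and independent: "finite S \<Longrightarrow> S \<subseteq> G \<Longrightarrow> (\<And>\<alpha>. \<alpha> \<in> S \<Longrightarrow> f \<alpha> \<in> C \<alpha>) \<Longrightarrow> sum f S = 0
      \<Longrightarrow> \<alpha> \<in> S \<Longrightarrow> f \<alpha> = 0"
begin

section \<open>Homogeneous components and supports\<close>

definition total :: "('g \<Rightarrow> 'k) \<Rightarrow> 'k" where
  "total f = (\<Sum>\<alpha> | f \<alpha> \<noteq> 0. f \<alpha>)"

definition T :: "'k set" where
  "T = total ` finite_families G C"

text \<open>Meaningful only on \<open>T\<close>, where the decomposing family exists and is unique;
  hence the premise \<open>y \<in> T\<close> in most of what follows. For such \<open>y\<close>,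
  degrees outside \<open>G\<close> have component \<open>0\<close>.\<close>

definition hcomp :: "'k \<Rightarrow> 'g \<Rightarrow> 'k" where
  "hcomp y = (THE f. f \<in> finite_families G C \<and> total f = y)"

definition supp :: "'k \<Rightarrow> 'g set" where
  "supp y = {\<alpha>. hcomp y \<alpha> \<noteq> 0}"

lemma total_eq_sum: "finite S \<Longrightarrow> {\<alpha>. f \<alpha> \<noteq> 0} \<subseteq> S \<Longrightarrow> total f = sum f S"
  unfolding total_def by (rule sum.mono_neutral_left) auto

lemma finite_families_eqI:
  assumes f: "f \<in> finite_families G C" and g: "g \<in> finite_families G C" and eq: "total f = total g"
  shows "f = g"
proof
  fix \<alpha>
  define S where "S = {\<alpha>. f \<alpha> \<noteq> 0} \<union> {\<alpha>. g \<alpha> \<noteq> 0}"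
  have S: "finite S" "S \<subseteq> G" using f g unfolding S_def finite_families_def by auto
  have "sum (\<lambda>\<alpha>. f \<alpha> - g \<alpha>) S = 0"
    using eq total_eq_sum[OF S(1), of f] total_eq_sum[OF S(1), of g]
    by (simp add: sum_subtractf S_def)
  moreover have "f \<alpha> - g \<alpha> \<in> C \<alpha>" if "\<alpha> \<in> S" for \<alpha>
    using f g S that C_subgroup additive_subgroup_of_diff unfolding finite_families_def by blast
  ultimately have "\<alpha> \<in> S \<Longrightarrow> f \<alpha> - g \<alpha> = 0"
    using independent[OF S, of "\<lambda>\<alpha>. f \<alpha> - g \<alpha>"] by blast
  then show "f \<alpha> = g \<alpha>" unfolding S_def by (cases "f \<alpha> = 0 \<and> g \<alpha> = 0") auto
qed

lemma hcomp_total: "f \<in> finite_families G C \<Longrightarrow> hcomp (total f) = f"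
  unfolding hcomp_def by (rule the_equality) (auto intro: finite_families_eqI)

lemma sum_in_T:
  assumes "finite S" "S \<subseteq> G" "\<And>\<alpha>. \<alpha> \<in> S \<Longrightarrow> f \<alpha> \<in> C \<alpha>"
  shows "sum f S \<in> T" and "hcomp (sum f S) = (\<lambda>\<beta>. if \<beta> \<in> S then f \<beta> else 0)"
proof -
  let ?g = "\<lambda>\<beta>. if \<beta> \<in> S then f \<beta> else 0"
  have g: "?g \<in> finite_families G C"
    using assms additive_subgroup_of_0[OF C_subgroup] unfolding finite_families_def by auto
  moreover have "total ?g = sum ?g S" by (rule total_eq_sum) (use assms in auto)
  ultimately have *: "total ?g = sum f S" by simp
  show "sum f S \<in> T" unfolding T_def using g by (rule image_eqI[rotated]) (simp add: *)
  show "hcomp (sum f S) = ?g" using hcomp_total[OF g] by (simp only: *)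
qed

lemma
  assumes "y \<in> T"
  shows hcomp_in_C: "\<alpha> \<in> G \<Longrightarrow> hcomp y \<alpha> \<in> C \<alpha>"
    and supp_subset: "supp y \<subseteq> G"
    and finite_supp: "finite (supp y)"
    and sum_hcomp_supp: "sum (hcomp y) (supp y) = y"
proof -
  obtain f where f: "f \<in> finite_families G C" "y = total f"
    using assms unfolding T_def by blast
  have c: "hcomp y = f" using hcomp_total f by simp
  show "\<alpha> \<in> G \<Longrightarrow> hcomp y \<alpha> \<in> C \<alpha>" "supp y \<subseteq> G" "finite (supp y)"
    using f unfolding finite_families_def supp_def c by auto
  show "sum (hcomp y) (supp y) = y" using f unfolding supp_def c total_def by simp
qed

lemma hcomp_outside: "\<alpha> \<notin> supp y \<Longrightarrow> hcomp y \<alpha> = 0"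
  by (simp add: supp_def)

lemma sum_hcomp:
  assumes "y \<in> T" "finite S" "supp y \<subseteq> S"
  shows "sum (hcomp y) S = y"
proof -
  have "sum (hcomp y) S = sum (hcomp y) (supp y)"
    using assms by (intro sum.mono_neutral_right) (auto simp: supp_def)
  then show ?thesis using sum_hcomp_supp assms by simp
qed

lemma hcomp_in_C_supp: "y \<in> T \<Longrightarrow> \<alpha> \<in> supp y \<Longrightarrow> hcomp y \<alpha> \<in> C \<alpha>"
  using hcomp_in_C supp_subset by blast

lemma C_imp_T: "\<alpha> \<in> G \<Longrightarrow> h \<in> C \<alpha> \<Longrightarrow> h \<in> T"
  using sum_in_T(1)[of "{\<alpha>}" "\<lambda>_. h"] by simp

lemma hcomp_homogeneous: "\<alpha> \<in> G \<Longrightarrow> h \<in> C \<alpha> \<Longrightarrow> hcomp h = (\<lambda>\<beta>. if \<beta> = \<alpha> then h else 0)"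
  using sum_in_T(2)[of "{\<alpha>}" "\<lambda>_. h"] by simp

lemma zero_T: "0 \<in> T" and hcomp_0 [simp]: "hcomp 0 \<alpha> = 0"
  using sum_in_T[of "{}"] by auto

lemma supp_0 [simp]: "supp 0 = {}"
  by (simp add: supp_def)

lemma supp_empty: "y \<in> T \<Longrightarrow> supp y = {} \<Longrightarrow> y = 0"
  using sum_hcomp_supp by fastforce

lemma hcomp_T: "y \<in> T \<Longrightarrow> hcomp y \<alpha> \<in> T"
  using hcomp_in_C_supp[of y \<alpha>] supp_subset[of y] C_imp_T[of \<alpha> "hcomp y \<alpha>"] zero_T
  by (cases "\<alpha> \<in> supp y") (auto simp: hcomp_outside)

lemma T_diff_aux:
  assumes y: "y \<in> T" and z: "z \<in> T"
  shows "y - z \<in> T \<and> hcomp (y - z) = (\<lambda>\<alpha>. hcomp y \<alpha> - hcomp z \<alpha>)"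
proof -
  let ?S = "supp y \<union> supp z"
  have S: "finite ?S" "?S \<subseteq> G" using finite_supp supp_subset y z by auto
  have *: "y - z = (\<Sum>\<alpha>\<in>?S. hcomp y \<alpha> - hcomp z \<alpha>)"
    using sum_hcomp[OF y S(1)] sum_hcomp[OF z S(1)] by (simp add: sum_subtractf)
  have "hcomp y \<alpha> - hcomp z \<alpha> \<in> C \<alpha>" if "\<alpha> \<in> ?S" for \<alpha>
    using S that y z hcomp_in_C C_subgroup additive_subgroup_of_diff by blast
  from sum_in_T[OF S this]
  have "y - z \<in> T" "hcomp (y - z) = (\<lambda>\<beta>. if \<beta> \<in> ?S then hcomp y \<beta> - hcomp z \<beta> else 0)"
    by (simp_all add: *)
  then show ?thesis by (auto simp: supp_def fun_eq_iff)
qed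

lemma T_diff: "y \<in> T \<Longrightarrow> z \<in> T \<Longrightarrow> y - z \<in> T"
  and hcomp_diff: "y \<in> T \<Longrightarrow> z \<in> T \<Longrightarrow> hcomp (y - z) \<alpha> = hcomp y \<alpha> - hcomp z \<alpha>"
  using T_diff_aux by auto

lemma T_uminus: "y \<in> T \<Longrightarrow> - y \<in> T"
  and hcomp_uminus: "y \<in> T \<Longrightarrow> hcomp (- y) \<alpha> = - hcomp y \<alpha>"
  using T_diff[OF zero_T, of y] hcomp_diff[OF zero_T, of y] by auto

lemma T_add: "y \<in> T \<Longrightarrow> z \<in> T \<Longrightarrow> y + z \<in> T"
  and hcomp_add: "y \<in> T \<Longrightarrow> z \<in> T \<Longrightarrow> hcomp (y + z) \<alpha> = hcomp y \<alpha> + hcomp z \<alpha>"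
  using T_diff[of y "- z"] hcomp_diff[of y "- z"] by (auto simp: T_uminus hcomp_uminus)

lemma T_sum: "(\<And>i. i \<in> S \<Longrightarrow> f i \<in> T) \<Longrightarrow> sum f S \<in> T"
  by (induction S rule: infinite_finite_induct) (auto simp: zero_T T_add)

lemma hcomp_sum: "(\<And>i. i \<in> S \<Longrightarrow> f i \<in> T) \<Longrightarrow> hcomp (sum f S) \<alpha> = (\<Sum>i\<in>S. hcomp (f i) \<alpha>)"
  by (induction S rule: infinite_finite_induct) (auto simp: hcomp_add T_sum)

lemma homogeneous_mult_aux:
  assumes \<alpha>: "\<alpha> \<in> G" "h \<in> C \<alpha>" and y: "y \<in> T"
  shows "h * y \<in> T \<and> hcomp (h * y) = (\<lambda>\<beta>. h * hcomp y (\<beta> - \<alpha>))"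
proof -
  let ?S = "(+) \<alpha> ` supp y"
  have S: "finite ?S" "?S \<subseteq> G"
    using finite_supp supp_subset[OF y] y \<alpha> additive_subgroup_of_add[OF subgroup_G] by auto
  have *: "h * y = (\<Sum>\<beta>\<in>?S. h * hcomp y (\<beta> - \<alpha>))"
    using sum_hcomp_supp[OF y] by (simp add: sum.reindex flip: sum_distrib_left)
  have "h * hcomp y (\<beta> - \<alpha>) \<in> C \<beta>" if "\<beta> \<in> ?S" for \<beta>
    using that C_mult[OF \<alpha>(1) _ \<alpha>(2) hcomp_in_C_supp[OF y]] supp_subset[OF y] by auto
  from sum_in_T[OF S this]
  have "h * y \<in> T" "hcomp (h * y) = (\<lambda>\<beta>. if \<beta> \<in> ?S then h * hcomp y (\<beta> - \<alpha>) else 0)"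
    by (simp_all add: *)
  moreover have "hcomp y (\<beta> - \<alpha>) = 0" if "\<beta> \<notin> ?S" for \<beta>
    using that by (intro hcomp_outside) (force simp: image_iff)
  ultimately show ?thesis by (auto simp: fun_eq_iff)
qed

lemma hcomp_homogeneous_mult:
  "\<alpha> \<in> G \<Longrightarrow> h \<in> C \<alpha> \<Longrightarrow> y \<in> T \<Longrightarrow> hcomp (h * y) \<beta> = h * hcomp y (\<beta> - \<alpha>)"
  using homogeneous_mult_aux by simp

lemma T_mult:
  assumes y: "y \<in> T" and z: "z \<in> T"
  shows "y * z \<in> T"
    and hcomp_mult: "hcomp (y * z) \<gamma> = (\<Sum>\<alpha>\<in>supp y. hcomp y \<alpha> * hcomp z (\<gamma> - \<alpha>))"
proof -
  have *: "y * z = (\<Sum>\<alpha>\<in>supp y. hcomp y \<alpha> * z)"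
    using sum_hcomp_supp[OF y] by (simp flip: sum_distrib_right)
  have aux: "hcomp y \<alpha> * z \<in> T \<and> hcomp (hcomp y \<alpha> * z) = (\<lambda>\<beta>. hcomp y \<alpha> * hcomp z (\<beta> - \<alpha>))"
    if "\<alpha> \<in> supp y" for \<alpha>
    using that supp_subset[OF y] by (intro homogeneous_mult_aux hcomp_in_C_supp y z) auto
  show "y * z \<in> T" unfolding * using aux by (intro T_sum) auto
  show "hcomp (y * z) \<gamma> = (\<Sum>\<alpha>\<in>supp y. hcomp y \<alpha> * hcomp z (\<gamma> - \<alpha>))"
    unfolding * using aux by (subst hcomp_sum) auto
qed

section \<open>Supports of products\<close>

lemma supp_mult:
  assumes "y \<in> T" "z \<in> T" "\<gamma> \<in> supp (y * z)"
  obtains \<alpha> \<beta> where "\<alpha> \<in> supp y" "\<beta> \<in> supp z" "\<gamma> = \<alpha> + \<beta>"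
proof -
  have "(\<Sum>\<alpha>\<in>supp y. hcomp y \<alpha> * hcomp z (\<gamma> - \<alpha>)) \<noteq> 0"
    using assms hcomp_mult[of y z \<gamma>] unfolding supp_def by simp
  then obtain \<alpha> where "\<alpha> \<in> supp y" "hcomp y \<alpha> * hcomp z (\<gamma> - \<alpha>) \<noteq> 0"
    by (meson sum.neutral)
  then show ?thesis using that[of \<alpha> "\<gamma> - \<alpha>"] by (simp add: supp_def)
qed

text \<open>The leading forms of \<open>y\<close> and \<open>z\<close> with respect to \<open>\<phi>\<close> have nonzero product, because \<open>T\<close>
  lies in a field.\<close>

lemma Max_supp_mult:
  fixes \<phi> :: "'g \<Rightarrow> 'o::linordered_ab_group_add"
  assumes A: "additive_subgroup_of A" "additive_on A \<phi>"
    and y: "y \<in> T" "y \<noteq> 0" "supp y \<subseteq> A" and z: "z \<in> T" "z \<noteq> 0" "supp z \<subseteq> A"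
  shows "Max (\<phi> ` supp (y * z)) = Max (\<phi> ` supp y) + Max (\<phi> ` supp z)"
proof (rule Max_eqI)
  have fin: "finite (\<phi> ` supp y)" "finite (\<phi> ` supp z)" using finite_supp y z by auto
  have add: "\<phi> (\<alpha> + \<beta>) = \<phi> \<alpha> + \<phi> \<beta>" if "\<alpha> \<in> supp y" "\<beta> \<in> supp z" for \<alpha> \<beta>
    using A that y z unfolding additive_on_def by blast
  define a b where "a = Max (\<phi> ` supp y)" and "b = Max (\<phi> ` supp z)"
  have le: "\<And>\<alpha>. \<alpha> \<in> supp y \<Longrightarrow> \<phi> \<alpha> \<le> a" "\<And>\<beta>. \<beta> \<in> supp z \<Longrightarrow> \<phi> \<beta> \<le> b"
    unfolding a_def b_def using fin by auto
  have "finite (supp (y * z))" using finite_supp T_mult y z by blast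
  then show "finite (\<phi> ` supp (y * z))" by simp
  show "c \<le> Max (\<phi> ` supp y) + Max (\<phi> ` supp z)" if "c \<in> \<phi> ` supp (y * z)" for c
  proof -
    from that obtain \<gamma> where \<gamma>: "\<gamma> \<in> supp (y * z)" "c = \<phi> \<gamma>" by blast
    then obtain \<alpha> \<beta> where "\<alpha> \<in> supp y" "\<beta> \<in> supp z" "\<gamma> = \<alpha> + \<beta>"
      using supp_mult y z by metis
    then show ?thesis using add \<gamma> fin by (simp add: add_mono)
  qed
  \<comment> \<open>\<open>\<phi>\<close> may attain its maximum at several degrees, so a leading
    form can have several components. The product of the leading forms is therefore shown to be
    nonzero as an element of the field, and \<open>\<gamma>\<close> is any degree in its
    support.\<close>
  define S1 S2 where "S1 = {\<alpha>\<in>supp y. \<phi> \<alpha> = a}" and "S2 = {\<beta>\<in>supp z. \<phi> \<beta> = b}"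
  define y1 z1 where "y1 = sum (hcomp y) S1" and "z1 = sum (hcomp z) S2"
  have "supp y \<noteq> {}" "supp z \<noteq> {}" using supp_empty y z by auto
  then have "a \<in> \<phi> ` supp y" "b \<in> \<phi> ` supp z" unfolding a_def b_def using fin by auto
  then have ne: "S1 \<noteq> {}" "S2 \<noteq> {}" unfolding S1_def S2_def by auto
  have y1: "y1 \<in> T" "hcomp y1 = (\<lambda>\<beta>. if \<beta> \<in> S1 then hcomp y \<beta> else 0)"
    unfolding y1_def S1_def using supp_subset[OF y(1)] finite_supp[OF y(1)] hcomp_in_C_supp[OF y(1)]
    by (intro sum_in_T; force)+
  have z1: "z1 \<in> T" "hcomp z1 = (\<lambda>\<beta>. if \<beta> \<in> S2 then hcomp z \<beta> else 0)"
    unfolding z1_def S2_def using supp_subset[OF z(1)] finite_supp[OF z(1)] hcomp_in_C_supp[OF z(1)]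
    by (intro sum_in_T; force)+
  have supp1: "supp y1 = S1" "supp z1 = S2"
    unfolding supp_def[of y1] supp_def[of z1] y1 z1 by (auto simp: S1_def S2_def supp_def)
  then have "y1 * z1 \<noteq> 0" using ne by auto
  moreover have "y1 * z1 \<in> T" using y1 z1 T_mult by blast
  ultimately obtain \<gamma> where \<gamma>: "\<gamma> \<in> supp (y1 * z1)" using supp_empty by blast
  then obtain \<alpha> \<beta> where "\<alpha> \<in> S1" "\<beta> \<in> S2" "\<gamma> = \<alpha> + \<beta>"
    using supp_mult y1 z1 supp1 by metis
  then have \<phi>\<gamma>: "\<phi> \<gamma> = a + b" using add by (auto simp: S1_def S2_def)
  have "hcomp (y * z) \<gamma> = (\<Sum>\<alpha>\<in>supp y. hcomp y \<alpha> * hcomp z (\<gamma> - \<alpha>))"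
    by (rule hcomp_mult) (use y z in auto)
  \<comment> \<open>A summand with \<alpha> outside \<open>S1\<close> would need \<gamma> - \<alpha>
    in \<open>supp z\<close> with value above \<open>b\<close>; so only the leading forms contribute
    in degree \<gamma>.\<close>
  also have "\<dots> = (\<Sum>\<alpha>\<in>S1. hcomp y1 \<alpha> * hcomp z1 (\<gamma> - \<alpha>))"
  proof (rule sum.mono_neutral_cong_right)
    show "finite (supp y)" using finite_supp y by blast
    have *: "\<phi> \<alpha> + \<phi> (\<gamma> - \<alpha>) = a + b" if "\<alpha> \<in> supp y" "\<gamma> - \<alpha> \<in> supp z" for \<alpha>
      using add[OF that] \<phi>\<gamma> by simp
    show "\<forall>\<alpha>\<in>supp y - S1. hcomp y \<alpha> * hcomp z (\<gamma> - \<alpha>) = 0"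
    proof
      fix \<alpha> assume \<alpha>: "\<alpha> \<in> supp y - S1"
      then have "\<phi> \<alpha> < a" using le unfolding S1_def by fastforce
      then have "\<gamma> - \<alpha> \<notin> supp z" using *[of \<alpha>] le(2)[of "\<gamma> - \<alpha>"] \<alpha>
        by (metis DiffD1 add_less_le_mono less_irrefl)
      then show "hcomp y \<alpha> * hcomp z (\<gamma> - \<alpha>) = 0" by (simp add: hcomp_outside)
    qed
    fix \<alpha> assume \<alpha>: "\<alpha> \<in> S1"
    then have "\<gamma> - \<alpha> \<in> S2 \<longleftrightarrow> \<gamma> - \<alpha> \<in> supp z"
      using *[of \<alpha>] unfolding S1_def S2_def by auto
    then show "hcomp y \<alpha> * hcomp z (\<gamma> - \<alpha>) = hcomp y1 \<alpha> * hcomp z1 (\<gamma> - \<alpha>)"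
      using \<alpha> by (simp add: y1 z1 hcomp_outside)
  qed (auto simp: S1_def)
  also have "\<dots> = hcomp (y1 * z1) \<gamma>"
    using hcomp_mult[OF y1(1) z1(1)] supp1 by simp
  finally have "\<gamma> \<in> supp (y * z)" using \<gamma> by (simp add: supp_def)
  then show "Max (\<phi> ` supp y) + Max (\<phi> ` supp z) \<in> \<phi> ` supp (y * z)"
    using \<phi>\<gamma> unfolding a_def b_def by (metis image_eqI)
qed

text \<open>Split off the part \<open>y1\<close> of \<open>y\<close> supported in the subgroup
  \<open>A\<close>. The rest times \<open>d\<close> is supported in the other cosets of
  \<open>A\<close>, yet it equals \<open>y * d - y1 * d\<close>, which is supported in
  \<open>A\<close>. So it vanishes, and \<open>d\<close> cancels.\<close>

lemma supp_cancel:
  assumes A: "additive_subgroup_of A" and y: "y \<in> T" and d: "d \<in> T" "d \<noteq> 0" "supp d \<subseteq> A"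
    and yd: "supp (y * d) \<subseteq> A"
  shows "supp y \<subseteq> A"
proof -
  define y1 where "y1 = sum (hcomp y) (supp y \<inter> A)"
  have y1: "y1 \<in> T" "hcomp y1 = (\<lambda>\<beta>. if \<beta> \<in> supp y \<inter> A then hcomp y \<beta> else 0)"
    unfolding y1_def using supp_subset[OF y(1)] finite_supp[OF y(1)] hcomp_in_C_supp[OF y(1)]
    by (intro sum_in_T; force)+
  have s1: "supp y1 \<subseteq> A" unfolding supp_def y1 by auto
  have s2: "supp (y - y1) \<inter> A = {}"
    using y y1 by (auto simp: supp_def hcomp_diff)
  have T: "y - y1 \<in> T" using y y1 T_diff by blast
  have "supp ((y - y1) * d) = {}"
  proof (rule ccontr)
    assume "supp ((y - y1) * d) \<noteq> {}"
    then obtain \<gamma> where \<gamma>: "\<gamma> \<in> supp ((y - y1) * d)" by blast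
    then obtain \<alpha> \<beta> where ab: "\<alpha> \<in> supp (y - y1)" "\<beta> \<in> supp d" "\<gamma> = \<alpha> + \<beta>"
      using supp_mult T d by metis
    then have "\<gamma> \<notin> A" using s2 d(3) additive_subgroup_of_diff[OF A, of \<gamma> \<beta>] by auto
    moreover have "supp (y1 * d) \<subseteq> A"
    proof
      fix \<delta> assume "\<delta> \<in> supp (y1 * d)"
      then obtain \<alpha> \<beta> where "\<alpha> \<in> supp y1" "\<beta> \<in> supp d" "\<delta> = \<alpha> + \<beta>"
        using supp_mult y1 d by metis
      then show "\<delta> \<in> A" using s1 d(3) additive_subgroup_of_add[OF A] by blast
    qed
    ultimately have "\<gamma> \<notin> supp (y * d)" "\<gamma> \<notin> supp (y1 * d)" using yd by blast+
    then have "hcomp (y * d - y1 * d) \<gamma> = 0"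
      using hcomp_diff[OF T_mult(1)[OF y d(1)] T_mult(1)[OF y1(1) d(1)]] by (simp add: hcomp_outside)
    then show False using \<gamma> by (simp add: supp_def algebra_simps)
  qed
  then have "(y - y1) * d = 0" using supp_empty T_mult T d by blast
  then show ?thesis using d s1 by simp
qed

text \<open>Uniqueness of decompositions is inherited from \<open>T\<close>, so directness amounts
  to closure under taking components. This trades a bijection of families for a condition on single
  elements.\<close>

lemma is_direct_sum_iff:
  assumes M: "additive_subgroup_of M"
  shows "is_direct_sum M G (\<lambda>\<alpha>. M \<inter> C \<alpha>) \<longleftrightarrow> M \<subseteq> T \<and> (\<forall>y\<in>M. \<forall>\<alpha>. hcomp y \<alpha> \<in> M)"
proof -
  let ?F = "finite_families G (\<lambda>\<alpha>. M \<inter> C \<alpha>)"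
  have sub: "?F \<subseteq> finite_families G C" unfolding finite_families_def by blast
  have total: "(\<lambda>f. \<Sum>i | f i \<noteq> 0. f i) = total" by (simp add: fun_eq_iff total_def)
  have inj: "inj_on total ?F" using sub by (auto intro!: inj_onI finite_families_eqI)
  have le: "total f \<in> M" if "f \<in> ?F" for f
    unfolding total_def using that by (intro additive_subgroup_of_sum[OF M]) (auto simp: finite_families_def)
  show ?thesis
  proof
    assume "is_direct_sum M G (\<lambda>\<alpha>. M \<inter> C \<alpha>)"
    then have img: "M = total ` ?F" unfolding is_direct_sum_def total bij_betw_def by simp
    show "M \<subseteq> T \<and> (\<forall>y\<in>M. \<forall>\<alpha>. hcomp y \<alpha> \<in> M)"
    proof (intro conjI ballI allI)
      show "M \<subseteq> T" using img sub unfolding T_def by blast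
      fix y \<alpha> assume "y \<in> M"
      then obtain f where f: "f \<in> ?F" "y = total f" using img by blast
      then have "hcomp y = f" using hcomp_total sub by blast
      moreover have "f \<alpha> \<in> M" using f additive_subgroup_of_0[OF M]
        by (cases "\<alpha> \<in> G") (auto simp: finite_families_def)
      ultimately show "hcomp y \<alpha> \<in> M" by simp
    qed
  next
    assume *: "M \<subseteq> T \<and> (\<forall>y\<in>M. \<forall>\<alpha>. hcomp y \<alpha> \<in> M)"
    have "M \<subseteq> total ` ?F"
    proof
      fix y assume y: "y \<in> M"
      then have yT: "y \<in> T" using * by blast
      have "hcomp y \<alpha> = 0" if "\<alpha> \<notin> G" for \<alpha> using that supp_subset[OF yT] by (auto simp: supp_def)
      then have "hcomp y \<in> ?F"
        using * y finite_supp[OF yT] hcomp_in_C[OF yT] by (auto simp: finite_families_def supp_def)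
      moreover have "total (hcomp y) = y"
        using sum_hcomp_supp[OF yT] by (simp add: total_def supp_def)
      ultimately show "y \<in> total ` ?F" by (metis image_eqI)
    qed
    then show "is_direct_sum M G (\<lambda>\<alpha>. M \<inter> C \<alpha>)"
      unfolding is_direct_sum_def total bij_betw_def using inj le by blast
  qed
qed

subsection \<open>A Dedekind--Mertens lemma\<close>

text \<open>For \<open>J\<close> in \<open>T\<close>, the span over \<open>R\<close> is the smallest
  homogeneous module containing \<open>J\<close>, an analogue of the content of a polynomial. The
  adjoined \<open>0\<close> ensures that deleting a component from an element of \<open>J\<close>
  creates no new member.\<close>

definition components :: "'k set \<Rightarrow> 'k set" where
  "components J = insert 0 (\<Union>a\<in>J. range (hcomp a))"

lemma hcomp_in_components: "a \<in> J \<Longrightarrow> hcomp a \<alpha> \<in> components J"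
  by (auto simp: components_def)

lemma finite_components:
  assumes "finite J" "J \<subseteq> T"
  shows "finite (components J)"
proof -
  have "finite (range (hcomp a))" if "a \<in> T" for a
  proof (rule finite_subset)
    show "range (hcomp a) \<subseteq> insert 0 (hcomp a ` supp a)" by (auto simp: supp_def)
    show "finite (insert 0 (hcomp a ` supp a))" using finite_supp that by simp
  qed
  then show ?thesis using assms unfolding components_def by auto
qed

text \<open>Taking all \<open>a \<in> J\<close> at once makes the exponent depend on the number of components of \<open>g\<close> only.
  The induction removes a pair of components \<open>f1\<close> of some \<open>a \<in> J\<close> and \<open>g1\<close> of \<open>g\<close> whose product is a
  component of \<open>a * g\<close>.\<close>

lemma dedekind_mertens:
  assumes "finite J" "J \<subseteq> T" "g \<in> T" "card (supp g) \<le> Suc n" "additive_subgroup_of M"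
    and "\<And>q a \<gamma>. q \<in> components J ^ n \<Longrightarrow> a \<in> J \<Longrightarrow> q * hcomp (a * g) \<gamma> \<in> M"
    and "p \<in> components J ^ Suc n"
  shows "p * hcomp g \<beta> \<in> M"
  using assms
proof (induction n arbitrary: J g M p \<beta> rule: less_induct)
  case (less n J g M p \<beta>)
  note IH = less.IH
  \<comment> \<open>The outer induction lowers \<open>n\<close> by removing a component from
    \<open>g\<close>; the inner one lowers the total number of components of the elements of
    \<open>J\<close>.\<close>
  show ?case
    using less.prems
  proof (induction "\<Sum>a\<in>J. card (supp a)" arbitrary: J p \<beta> rule: less_induct)
    case (less J p \<beta>)
    note J = less.prems(1,2) and g = less.prems(3,4) and M = less.prems(5,6) and p = less.prems(7)
    show ?case
    proof (cases "g = 0 \<or> J \<subseteq> {0}")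
      case True
      moreover have "p = 0" if "J \<subseteq> {0}"
      proof -
        from that have "components J \<subseteq> {0}" by (auto simp: components_def)
        with p show ?thesis by (auto elim!: set_times_elim)
      qed
      ultimately show ?thesis using additive_subgroup_of_0[OF M(1)] by auto
    next
      case False
      then obtain a where a: "a \<in> J" "a \<noteq> 0" by blast
      then have aT: "a \<in> T" using J by blast
      have "supp a \<noteq> {}" "supp g \<noteq> {}" using False a aT g supp_empty by auto
      then obtain \<alpha>1 \<beta>1 where ab: "\<alpha>1 \<in> supp a" "\<beta>1 \<in> supp g"
        and unique: "\<And>\<alpha> \<beta>. \<alpha> \<in> supp a \<Longrightarrow> \<beta> \<in> supp g \<Longrightarrow> \<alpha> + \<beta> = \<alpha>1 + \<beta>1 \<Longrightarrow> \<alpha> = \<alpha>1 \<and> \<beta> = \<beta>1"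
        using unique_product[OF subgroup_G torsion_free_G finite_supp[OF aT] _ supp_subset[OF aT]
            finite_supp[OF g(1)] _ supp_subset[OF g(1)]] by metis
      define f1 g1 a' g' where "f1 = hcomp a \<alpha>1" and "g1 = hcomp g \<beta>1"
        and "a' = a - f1" and "g' = g - g1"
      have f1: "f1 \<in> C \<alpha>1" "\<alpha>1 \<in> G" "f1 \<in> T" and g1: "g1 \<in> C \<beta>1" "\<beta>1 \<in> G" "g1 \<in> T"
        using ab aT g supp_subset by (auto simp: f1_def g1_def intro: hcomp_in_C_supp hcomp_T)
      have a'T: "a' \<in> T" and g'T: "g' \<in> T"
        using aT g f1 g1 by (auto simp: a'_def g'_def intro: T_diff)
      have hcomp_a': "hcomp a' \<gamma> = (if \<gamma> = \<alpha>1 then 0 else hcomp a \<gamma>)" for \<gamma>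
        using hcomp_diff[OF aT f1(3)] hcomp_homogeneous[OF f1(2,1)] by (simp add: a'_def f1_def)
      have hcomp_g': "hcomp g' \<gamma> = (if \<gamma> = \<beta>1 then 0 else hcomp g \<gamma>)" for \<gamma>
        using hcomp_diff[OF g(1) g1(3)] hcomp_homogeneous[OF g1(2,1)] by (simp add: g'_def g1_def)
      have supp_a': "supp a' = supp a - {\<alpha>1}" and supp_g': "supp g' = supp g - {\<beta>1}"
        by (auto simp: supp_def hcomp_a' hcomp_g')
      have lead: "hcomp (a * g) (\<alpha>1 + \<beta>1) = f1 * g1"
      proof -
        have "hcomp (a * g) (\<alpha>1 + \<beta>1) = (\<Sum>\<alpha>\<in>supp a. hcomp a \<alpha> * hcomp g (\<alpha>1 + \<beta>1 - \<alpha>))"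
          by (rule hcomp_mult[OF aT g(1)])
        also have "\<dots> = (\<Sum>\<alpha>\<in>{\<alpha>1}. hcomp a \<alpha> * hcomp g (\<alpha>1 + \<beta>1 - \<alpha>))"
        proof (rule sum.mono_neutral_right)
          show "\<forall>\<alpha>\<in>supp a - {\<alpha>1}. hcomp a \<alpha> * hcomp g (\<alpha>1 + \<beta>1 - \<alpha>) = 0"
          proof
            fix \<alpha> assume "\<alpha> \<in> supp a - {\<alpha>1}"
            then have "\<alpha>1 + \<beta>1 - \<alpha> \<notin> supp g" using unique[of \<alpha> "\<alpha>1 + \<beta>1 - \<alpha>"] by auto
            then show "hcomp a \<alpha> * hcomp g (\<alpha>1 + \<beta>1 - \<alpha>) = 0" by (simp add: hcomp_outside)
          qed
        qed (use ab finite_supp aT in auto)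
        finally show ?thesis by (simp add: f1_def g1_def)
      qed
      have f1P: "f1 \<in> components J" unfolding f1_def by (rule hcomp_in_components[OF a(1)])
      \<comment> \<open>The products containing \<open>f1\<close>. In degree \<beta>1 the factor
        \<open>f1 * g1\<close> is a full component of \<open>a * g\<close>, by uniqueness of the
        pair; in all other degrees \<open>g\<close> can be replaced by \<open>g'\<close>, which has
        fewer components.\<close>
      have with_f1: "f1 * q * hcomp g \<gamma> \<in> M" if q: "q \<in> components J ^ n" for q \<gamma>
      proof (cases "\<gamma> = \<beta>1")
        case True
        have "q * hcomp (a * g) (\<alpha>1 + \<beta>1) \<in> M" using M(2) q a by blast
        then show ?thesis unfolding True lead g1_def by (simp add: ac_simps)
      next
        case False
        then have *: "hcomp g \<gamma> = hcomp g' \<gamma>" by (simp add: hcomp_g')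
        have card_g': "card (supp g') < card (supp g)"
          unfolding supp_g' by (rule card_Diff1_less[OF finite_supp[OF g(1)] ab(2)])
        show ?thesis
        proof (cases n)
          case 0
          then have "card (supp g') = 0" using card_g' g(2) by simp
          then have "g' = 0" using supp_empty[OF g'T] finite_supp[OF g'T] by simp
          then show ?thesis using additive_subgroup_of_0[OF M(1)] * by simp
        next
          case (Suc m)
          \<comment> \<open>The colon of \<open>M\<close> by \<open>f1\<close>: fixing
            \<open>f1\<close> uses up one factor from \<open>components J\<close>, which matches the
            drop of the exponent from \<open>n\<close> to \<open>m\<close>. The induction therefore
            has to range over all subgroups \<open>M\<close>.\<close>
          define M' where "M' = {z. f1 * z \<in> M}"
          have "additive_subgroup_of M'"
            using M(1) unfolding M'_def additive_subgroup_of_def by (auto simp: algebra_simps)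
          moreover have "q' * hcomp (b * g') \<delta> \<in> M'"
            if q': "q' \<in> components J ^ m" and b: "b \<in> J" for q' b \<delta>
          proof -
            have bT: "b \<in> T" using b J by blast
            have "b * g' = b * g - g1 * b" by (simp add: g'_def algebra_simps)
            then have hb: "hcomp (b * g') \<delta> = hcomp (b * g) \<delta> - g1 * hcomp b (\<delta> - \<beta>1)"
              using hcomp_diff[OF T_mult(1)[OF bT g(1)] T_mult(1)[OF g1(3) bT]]
                hcomp_homogeneous_mult[OF g1(2,1) bT] by simp
            \<comment> \<open>The correction term again contains \<open>f1 * g1\<close>, a component
              of \<open>a * g\<close>, preceded by a product of \<open>n\<close> factors from
              \<open>components J\<close>.\<close>
            then have eq: "f1 * (q' * hcomp (b * g') \<delta>) =
                (f1 * q') * hcomp (b * g) \<delta> - (hcomp b (\<delta> - \<beta>1) * q') * (f1 * g1)"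
              unfolding hb by (simp add: algebra_simps)
            have "f1 * q' \<in> components J ^ n" "hcomp b (\<delta> - \<beta>1) * q' \<in> components J ^ n"
              unfolding Suc power_Suc by (intro set_times_intro f1P q' hcomp_in_components[OF b])+
            then have "(f1 * q') * hcomp (b * g) \<delta> \<in> M"
              "(hcomp b (\<delta> - \<beta>1) * q') * (f1 * g1) \<in> M"
              using M(2) b a(1) unfolding lead[symmetric] by blast+
            then show ?thesis unfolding M'_def using eq additive_subgroup_of_diff[OF M(1)] by simp
          qed
          moreover have "card (supp g') \<le> Suc m" using card_g' g(2) Suc by simp
          ultimately have "q * hcomp g' \<gamma> \<in> M'"
            using IH[of m J g' M' q \<gamma>] J g'T q Suc by simp
          then show ?thesis unfolding M'_def * by (simp add: ac_simps)
        qed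
      qed
      \<comment> \<open>Products not covered by \<open>with_f1\<close> consist of components of
        \<open>J'\<close>, so the inner induction applies once its premise is checked. In
        \<open>a' * g = a * g - f1 * g\<close> the second term is handled by
        \<open>with_f1\<close>.\<close>
      define J' where "J' = insert a' (J - {a})"
      have "components J \<subseteq> insert f1 (components J')"
      proof
        fix z assume "z \<in> components J"
        then consider "z = 0" | \<gamma> where "z = hcomp a \<gamma>" | b \<gamma> where "b \<in> J - {a}" "z = hcomp b \<gamma>"
          unfolding components_def by blast
        then show "z \<in> insert f1 (components J')"
        proof cases
          case 2
          then show ?thesis using hcomp_a'[of \<gamma>] hcomp_in_components[of a' J' \<gamma>]
            by (auto simp: J'_def f1_def split: if_splits)
        qed (auto simp: components_def J'_def)
      qed
      from power_Suc_insert_cases[OF this p] show ?thesis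
      proof
        assume "\<exists>q\<in>components J ^ n. p = f1 * q"
        then show ?thesis using with_f1 by blast
      next
        assume p': "p \<in> components J' ^ Suc n"
        have "components J' \<subseteq> components J"
        proof
          fix z assume "z \<in> components J'"
          then consider "z = 0" | \<gamma> where "z = hcomp a' \<gamma>" | b \<gamma> where "b \<in> J" "z = hcomp b \<gamma>"
            unfolding components_def J'_def by blast
          then show "z \<in> components J"
            by cases (use a(1) in \<open>auto simp: hcomp_a' components_def\<close>)
        qed
        then have mono: "components J' ^ n \<subseteq> components J ^ n" by (rule power_set_mono)
        have "q * hcomp (b * g) \<gamma> \<in> M" if q: "q \<in> components J' ^ n" and b: "b \<in> J'" for q b \<gamma>
        proof (cases "b \<in> J")
          case True
          then show ?thesis using M(2) q mono by blast
        next
          case False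
          then have "b = a - f1" using b by (simp add: J'_def a'_def)
          then have "b * g = a * g - f1 * g" by (simp add: left_diff_distrib)
          then have hb: "hcomp (b * g) \<gamma> = hcomp (a * g) \<gamma> - f1 * hcomp g (\<gamma> - \<alpha>1)"
            using hcomp_diff[OF T_mult(1)[OF aT g(1)] T_mult(1)[OF f1(3) g(1)]]
                hcomp_homogeneous_mult[OF f1(2,1) g(1)] by simp
          have "q * hcomp (b * g) \<gamma> = q * hcomp (a * g) \<gamma> - f1 * q * hcomp g (\<gamma> - \<alpha>1)"
            unfolding hb by (simp add: algebra_simps)
          moreover have "q * hcomp (a * g) \<gamma> \<in> M" "f1 * q * hcomp g (\<gamma> - \<alpha>1) \<in> M"
            using M(2) with_f1 a(1) q mono by blast+
          ultimately show ?thesis using additive_subgroup_of_diff[OF M(1)] by simp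
        qed
        moreover have "(\<Sum>b\<in>J'. card (supp b)) < (\<Sum>b\<in>J. card (supp b))"
        proof -
          \<comment> \<open>Only an inequality, since \<open>a'\<close> may already occur in
            \<open>J - {a}\<close>.\<close>
          have "(\<Sum>b\<in>J'. card (supp b)) \<le> card (supp a') + (\<Sum>b\<in>J - {a}. card (supp b))"
            using J(1) unfolding J'_def by (simp add: sum.insert_if)
          also have "\<dots> < card (supp a) + (\<Sum>b\<in>J - {a}. card (supp b))"
            unfolding supp_a' using card_Diff1_less[OF finite_supp[OF aT] ab(1)] by simp
          also have "\<dots> = (\<Sum>b\<in>J. card (supp b))" using J(1) a(1) by (simp add: sum.remove)
          finally show ?thesis .
        qed
        moreover have "finite J'" "J' \<subseteq> T" using J a'T by (auto simp: J'_def)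
        ultimately show ?thesis using less.hyps[of J' p \<beta>] g M(1) p' by blast
      qed
    qed
  qed
qed

subsection \<open>Complete integral closedness\<close>

text \<open>The multiples \<open>n * (\<epsilon> - \<delta>)\<close> of the difference of leading degrees occur, up to the shift by
  \<open>\<delta>\<close>, in the support of \<open>c * (e / c) ^ n\<close>; comparing growth rates in \<open>n\<close> gives the bound.\<close>

lemma leading_difference_le:
  fixes \<psi> :: "'g \<Rightarrow> 'o::linordered_ab_group_add" and \<phi> :: "'g \<Rightarrow> int"
  assumes A: "additive_subgroup_of A" and \<psi>: "additive_on A \<psi>" "inj_on \<psi> A"
    and \<phi>: "additive_on A \<phi>"
    and c: "c \<in> T" "c \<noteq> 0" "supp c \<subseteq> A" and e: "e \<in> T" "e \<noteq> 0" "supp e \<subseteq> A"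
    and almost_integral: "\<And>n. c * (e / c) ^ n \<in> T"
    and \<epsilon>: "\<epsilon> \<in> supp e" "\<psi> \<epsilon> = Max (\<psi> ` supp e)"
    and \<delta>: "\<delta> \<in> supp c" "\<psi> \<delta> = Max (\<psi> ` supp c)"
    and \<alpha>: "\<alpha> \<in> supp c"
  shows "\<phi> (\<epsilon> - \<delta> + \<alpha>) \<le> Max (\<phi> ` supp e)"
proof -
  define y where "y n = c * (e / c) ^ n" for n
  have yT: "y n \<in> T" for n unfolding y_def by (rule almost_integral)
  have y0: "y n \<noteq> 0" for n unfolding y_def using c e by simp
  \<comment> \<open>This recurrence is free of division: it governs the maxima of the supports and,
    through \<open>supp_cancel\<close>, keeps the supports inside \<open>A\<close>.\<close>
  have y_Suc: "y (Suc n) * c = y n * e" for n unfolding y_def using c by (simp add: field_simps)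
  have yA: "supp (y n) \<subseteq> A" for n
  proof (induction n)
    case 0
    then show ?case using c by (simp add: y_def)
  next
    case (Suc n)
    have "supp (y n * e) \<subseteq> A"
      using Suc e additive_subgroup_of_add[OF A] supp_mult[OF yT e(1)] by (metis subset_iff)
    then show ?case using supp_cancel[OF A yT c] y_Suc by metis
  qed
  have rec: "Max (\<chi> ` supp (y (Suc n))) + Max (\<chi> ` supp c) = Max (\<chi> ` supp (y n)) + Max (\<chi> ` supp e)"
    if "additive_on A \<chi>" for n and \<chi> :: "'g \<Rightarrow> 'q::linordered_ab_group_add"
    using Max_supp_mult[OF A that yT y0 yA c, of "Suc n"] Max_supp_mult[OF A that yT y0 yA e, of n]
      y_Suc[of n] by simp
  \<comment> \<open>The candidate for the leading degree of \<open>y n\<close> with respect to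
    \<open>\<psi>\<close>: it starts at \<delta>, and each factor \<open>e / c\<close> adds
    \<epsilon> - \<delta>.\<close>
  define \<alpha>s where "\<alpha>s n = \<delta> + zmul (int n) (\<epsilon> - \<delta>)" for n
  have \<epsilon>A: "\<epsilon> \<in> A" and \<delta>A: "\<delta> \<in> A" and \<alpha>A: "\<alpha> \<in> A" using \<epsilon> \<delta> \<alpha> c e by auto
  have \<alpha>sA: "\<alpha>s n \<in> A" for n
    unfolding \<alpha>s_def using A \<epsilon>A \<delta>A
    by (intro additive_subgroup_of_add additive_subgroup_of_zmul additive_subgroup_of_diff)
  have \<alpha>s_Suc: "\<alpha>s (Suc n) + \<delta> = \<alpha>s n + \<epsilon>" for n
    using zmul_plus1[of "int n" "\<epsilon> - \<delta>"] by (simp add: \<alpha>s_def add.commute)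
  have \<alpha>s_rec: "\<chi> (\<alpha>s (Suc n)) + \<chi> \<delta> = \<chi> (\<alpha>s n) + \<chi> \<epsilon>"
    if "additive_on A \<chi>" for n and \<chi> :: "'g \<Rightarrow> 'q::linordered_ab_group_add"
    using that \<alpha>s_Suc[of n] \<epsilon>A \<delta>A \<alpha>sA unfolding additive_on_def by metis
  have lead: "\<psi> (\<alpha>s n) = Max (\<psi> ` supp (y n))" for n
  proof (induction n)
    case 0
    then show ?case using \<delta> by (simp add: \<alpha>s_def y_def)
  next
    case (Suc n)
    have "\<psi> (\<alpha>s (Suc n)) + \<psi> \<delta> = Max (\<psi> ` supp (y (Suc n))) + \<psi> \<delta>"
      using \<alpha>s_rec[OF \<psi>(1), of n] rec[OF \<psi>(1), of n] Suc \<epsilon> \<delta> by simp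
    then show ?case by simp
  qed
  have mem: "\<alpha>s n \<in> supp (y n)" for n
  proof -
    have "Max (\<psi> ` supp (y n)) \<in> \<psi> ` supp (y n)"
      using finite_supp[OF yT] supp_empty[OF yT] y0 by (intro Max_in) auto
    then obtain \<beta> where "\<beta> \<in> supp (y n)" "\<psi> (\<alpha>s n) = \<psi> \<beta>" using lead by auto
    then show ?thesis using inj_onD[OF \<psi>(2)] \<alpha>sA yA by (metis subset_iff)
  qed
  define m\<^sub>c m\<^sub>e where "m\<^sub>c = Max (\<phi> ` supp c)" and "m\<^sub>e = Max (\<phi> ` supp e)"
  have 1: "\<phi> (\<alpha>s n) = \<phi> \<delta> + int n * (\<phi> \<epsilon> - \<phi> \<delta>)" for n
  proof (induction n)
    case (Suc n)
    then show ?case using \<alpha>s_rec[OF \<phi>, of n] by (simp add: algebra_simps)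
  qed (simp add: \<alpha>s_def)
  have 2: "Max (\<phi> ` supp (y n)) = m\<^sub>c + int n * (m\<^sub>e - m\<^sub>c)" for n
  proof (induction n)
    case (Suc n)
    then show ?case using rec[OF \<phi>, of n] by (simp add: algebra_simps m\<^sub>c_def m\<^sub>e_def)
  qed (simp add: y_def m\<^sub>c_def)
  have 3: "\<phi> \<delta> + int n * (\<phi> \<epsilon> - \<phi> \<delta>) \<le> m\<^sub>c + int n * (m\<^sub>e - m\<^sub>c)" for n
    unfolding 1[symmetric] 2[symmetric] using mem finite_supp[OF yT] by (intro Max_ge) auto
  have "\<phi> \<epsilon> - \<phi> \<delta> \<le> m\<^sub>e - m\<^sub>c"
  proof (rule ccontr)
    assume "\<not> ?thesis"
    then have k: "(\<phi> \<epsilon> - \<phi> \<delta>) - (m\<^sub>e - m\<^sub>c) \<ge> 1" by simp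
    \<comment> \<open>If the slope of \<open>\<phi>\<close> along the leading degrees exceeded
      \<open>m\<^sub>e - m\<^sub>c\<close>, integrality would make the excess after \<open>n\<close>
      steps at least \<open>n\<close>. It is at most \<open>m\<^sub>c - \<phi> \<delta>\<close>, and
      this \<open>n\<close> is larger.\<close>
    define n where "n = Suc (nat (m\<^sub>c - \<phi> \<delta>))"
    have "int n * 1 \<le> int n * ((\<phi> \<epsilon> - \<phi> \<delta>) - (m\<^sub>e - m\<^sub>c))" by (intro mult_left_mono k) simp
    also have "\<dots> \<le> m\<^sub>c - \<phi> \<delta>" using 3[of n] by (simp add: algebra_simps)
    finally show False unfolding n_def by (simp split: if_splits)
  qed
  moreover have "\<phi> \<alpha> \<le> m\<^sub>c" unfolding m\<^sub>c_def using \<alpha> finite_supp[OF c(1)] by auto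
  moreover have "\<phi> (\<epsilon> - \<delta> + \<alpha>) = \<phi> \<epsilon> - \<phi> \<delta> + \<phi> \<alpha>"
    using \<phi> additive_on_diff[OF A \<phi> \<epsilon>A \<delta>A] additive_subgroup_of_diff[OF A \<epsilon>A \<delta>A] \<alpha>A
    unfolding additive_on_def by simp
  ultimately show ?thesis unfolding m\<^sub>e_def by linarith
qed

text \<open>Leading terms of \<open>x = e / c\<close> are split off one after another; the supports of the remaining
  numerators stay inside a fixed finite box, so this terminates.\<close>

lemma completely_integrally_closed:
  assumes c: "c \<in> T" "c \<noteq> 0" and x: "\<And>n. c * x ^ n \<in> T"
  shows "x \<in> T"
proof -
  have cx: "c * x \<in> T" using x[of 1] by simp
  have "finite (supp c \<union> supp (c * x))" "supp c \<union> supp (c * x) \<subseteq> G"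
    using finite_supp supp_subset c cx by auto
  then obtain A r and \<psi> :: "'g \<Rightarrow> (nat \<Rightarrow>\<^sub>0 int)" where A: "additive_subgroup_of A"
    and suppA: "supp c \<subseteq> A" "supp (c * x) \<subseteq> A" and AG: "A \<subseteq> G"
    and \<psi>: "additive_on A \<psi>" "inj_on \<psi> A"
    and keys: "\<And>a. a \<in> A \<Longrightarrow> Poly_Mapping.keys (\<psi> a) \<subseteq> {..<r}"
    using embed_finitely_generated_torsion_free[OF _ _ subgroup_G torsion_free_G] by (metis Un_subset_iff)
  define \<phi> where "\<phi> i \<alpha> = Poly_Mapping.lookup (\<psi> \<alpha>) i" for i \<alpha>
  \<comment> \<open>The largest absolute value of coordinate \<open>i\<close> on the degrees of the
    numerator; the inserted \<open>0\<close> keeps \<open>Max\<close> meaningful when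
    \<open>x = 0\<close>.\<close>
  define B where "B i = Max (insert 0 ((\<lambda>\<alpha>. \<bar>\<phi> i \<alpha>\<bar>) ` supp (c * x)))" for i
  define S where "S = {\<alpha> \<in> A. \<forall>i<r. \<bar>\<phi> i \<alpha>\<bar> \<le> B i}"
  have S: "finite S"
  proof (rule inj_on_finite)
    let ?f = "\<lambda>\<alpha>. restrict (\<lambda>i. \<phi> i \<alpha>) {..<r}"
    show "finite (PiE {..<r} (\<lambda>i. {- B i .. B i}))" by (intro finite_PiE) auto
    show "?f ` S \<subseteq> PiE {..<r} (\<lambda>i. {- B i .. B i})"
      by (rule image_subsetI, subst restrict_PiE_iff) (auto simp: S_def abs_le_iff)
    show "inj_on ?f S"
    proof
      fix \<alpha> \<beta> assume ab: "\<alpha> \<in> S" "\<beta> \<in> S" "?f \<alpha> = ?f \<beta>"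
      have "\<psi> \<alpha> = \<psi> \<beta>"
      proof (rule poly_mapping_eqI)
        fix i
        show "Poly_Mapping.lookup (\<psi> \<alpha>) i = Poly_Mapping.lookup (\<psi> \<beta>) i"
        proof (cases "i < r")
          case True
          then show ?thesis using fun_cong[OF ab(3), of i] by (simp add: \<phi>_def)
        next
          case False
          then have "i \<notin> Poly_Mapping.keys (\<psi> \<alpha>)" "i \<notin> Poly_Mapping.keys (\<psi> \<beta>)"
            using keys[of \<alpha>] keys[of \<beta>] ab unfolding S_def by auto
          then show ?thesis by (simp add: in_keys_iff)
        qed
      qed
      then show "\<alpha> = \<beta>" using inj_onD[OF \<psi>(2)] ab unfolding S_def by blast
    qed
  qed
  \<comment> \<open>Both signs are recorded because \<open>leading_difference_le\<close> bounds from
    above only.\<close>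
  have \<phi>_add: "additive_on A (\<phi> i)" "additive_on A (\<lambda>\<alpha>. - \<phi> i \<alpha>)" for i
    using \<psi>(1) unfolding additive_on_def \<phi>_def by (auto simp: lookup_add)
  have "supp c \<noteq> {}" using supp_empty c by blast
  then have "Max (\<psi> ` supp c) \<in> \<psi> ` supp c" using finite_supp[OF c(1)] by (intro Max_in) auto
  then obtain \<delta> where \<delta>: "\<delta> \<in> supp c" "\<psi> \<delta> = Max (\<psi> ` supp c)" by auto
  \<comment> \<open>The measure counts the degrees of the box not exceeding the leading degree of
    the numerator. It drops because the next leading degree is strictly smaller and the old one lies
    in the box.\<close>
  have main: "e / c \<in> T" if "e \<in> T" "supp e \<subseteq> S" "\<And>n. c * (e / c) ^ n \<in> T" for e
    using that
  proof (induction "card {\<alpha> \<in> S. \<psi> \<alpha> \<le> Max (\<psi> ` supp e)}" arbitrary: e rule: less_induct)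
    case (less e)
    note e = less.prems
    show ?case
    proof (cases "e = 0")
      case True
      then show ?thesis using zero_T by simp
    next
      case False
      have eA: "supp e \<subseteq> A" using e(2) unfolding S_def by blast
      have fin: "finite (supp e)" by (rule finite_supp[OF e(1)])
      have "Max (\<psi> ` supp e) \<in> \<psi> ` supp e" using fin supp_empty e(1) False by (intro Max_in) auto
      then obtain \<epsilon> where \<epsilon>: "\<epsilon> \<in> supp e" "\<psi> \<epsilon> = Max (\<psi> ` supp e)" by auto
      have AA: "\<epsilon> \<in> A" "\<delta> \<in> A" using \<epsilon> \<delta> eA suppA by auto
      have G: "\<epsilon> - \<delta> \<in> A" "\<epsilon> - \<delta> \<in> G" using additive_subgroup_of_diff[OF A AA] AG by auto
      \<comment> \<open>The quotient of the leading components of \<open>e\<close> and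
        \<open>c\<close>, homogeneous of degree \<epsilon> - \<delta>. Subtracting it from
        \<open>e / c\<close> cancels the component of the numerator in degree \<epsilon>.\<close>
      define u where "u = hcomp e \<epsilon> * inverse (hcomp c \<delta>)"
      have u: "u \<in> C (\<epsilon> - \<delta>)"
        using C_mult[OF _ _ hcomp_in_C_supp[OF e(1) \<epsilon>(1)] C_inverse[OF _ hcomp_in_C_supp[OF c(1) \<delta>(1)]]]
          AA AG additive_subgroup_of_uminus[OF subgroup_G] unfolding u_def by (simp add: subset_iff)
      have uT: "u \<in> T" using u G C_imp_T by blast
      have uc: "hcomp (u * c) \<beta> = u * hcomp c (\<beta> - (\<epsilon> - \<delta>))" for \<beta>
        by (rule hcomp_homogeneous_mult[OF G(2) u c(1)])
      define e' where "e' = e - u * c"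
      have e'T: "e' \<in> T" unfolding e'_def by (intro T_diff T_mult(1) e(1) uT c(1))
      have hcomp_e': "hcomp e' \<beta> = hcomp e \<beta> - u * hcomp c (\<beta> - (\<epsilon> - \<delta>))" for \<beta>
        unfolding e'_def using hcomp_diff[OF e(1) T_mult(1)[OF uT c(1)]] uc by simp
      have e'c: "e' / c = e / c - u" using c by (simp add: e'_def diff_divide_distrib)
      have supp_e': "\<beta> \<in> supp e \<or> (\<exists>\<alpha>\<in>supp c. \<beta> = \<epsilon> - \<delta> + \<alpha>)" if "\<beta> \<in> supp e'" for \<beta>
      proof (rule ccontr)
        assume "\<not> ?thesis"
        then have "\<beta> \<notin> supp e" "\<beta> - (\<epsilon> - \<delta>) \<notin> supp c"
          by (auto dest: bspec[of _ _ "\<beta> - (\<epsilon> - \<delta>)"])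
        then have "hcomp e' \<beta> = 0" by (simp add: hcomp_e' hcomp_outside)
        then show False using that by (simp add: supp_def)
      qed
      have "supp e' \<subseteq> S"
      proof
        fix \<beta> assume "\<beta> \<in> supp e'"
        from supp_e'[OF this] show "\<beta> \<in> S"
        proof
          assume "\<beta> \<in> supp e"
          then show ?thesis using e(2) by blast
        next
          assume "\<exists>\<alpha>\<in>supp c. \<beta> = \<epsilon> - \<delta> + \<alpha>"
          then obtain \<alpha> where \<alpha>: "\<alpha> \<in> supp c" "\<beta> = \<epsilon> - \<delta> + \<alpha>" by blast
          have bound: "\<chi> \<beta> \<le> Max (\<chi> ` supp e)" if "additive_on A \<chi>" for \<chi> :: "'g \<Rightarrow> int"
            unfolding \<alpha>(2)
            by (rule leading_difference_le[OF A \<psi> that c suppA(1) e(1) False eA e(3) \<epsilon> \<delta> \<alpha>(1)])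
          have "\<bar>\<phi> i \<beta>\<bar> \<le> B i" if i: "i < r" for i
          proof -
            have *: "\<bar>\<phi> i \<alpha>\<bar> \<le> B i" if "\<alpha> \<in> supp e" for \<alpha>
              using e(2) that i unfolding S_def by blast
            have "Max (\<phi> i ` supp e) \<le> B i" "Max ((\<lambda>\<alpha>. - \<phi> i \<alpha>) ` supp e) \<le> B i"
              using fin \<epsilon>(1) * by (subst Max_le_iff; force simp: abs_le_iff)+
            then show ?thesis using bound[OF \<phi>_add(1), of i] bound[OF \<phi>_add(2), of i] by linarith
          qed
          moreover have "\<beta> \<in> A" using \<alpha> suppA additive_subgroup_of_add[OF A G(1)] by blast
          ultimately show ?thesis unfolding S_def by blast
        qed
      qed
      moreover have "c * (e' / c) ^ n \<in> T" for n
      proof -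
        \<comment> \<open>Mixed powers make the induction run: expanding one factor
          \<open>e' / c = e / c - u\<close> at a time raises \<open>m\<close> in one of the two
          terms.\<close>
        have "c * (e / c) ^ m * (e' / c) ^ n \<in> T" for m
        proof (induction n arbitrary: m)
          case 0
          then show ?case using e(3) by simp
        next
          case (Suc n)
          have "c * (e / c) ^ m * (e' / c) ^ Suc n =
              c * (e / c) ^ Suc m * (e' / c) ^ n - u * (c * (e / c) ^ m * (e' / c) ^ n)"
            by (simp add: e'c algebra_simps)
          also have "\<dots> \<in> T" by (intro T_diff T_mult(1) uT Suc)
          finally show ?case .
        qed
        from this[of 0] show ?thesis by simp
      qed
      moreover have "card {\<alpha> \<in> S. \<psi> \<alpha> \<le> Max (\<psi> ` supp e')} < card {\<alpha> \<in> S. \<psi> \<alpha> \<le> Max (\<psi> ` supp e)}"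
        if "e' \<noteq> 0"
      proof (rule psubset_card_mono)
        show "finite {\<alpha> \<in> S. \<psi> \<alpha> \<le> Max (\<psi> ` supp e)}" using S by simp
        have "\<psi> \<beta> < \<psi> \<epsilon>" if \<beta>: "\<beta> \<in> supp e'" for \<beta>
        proof -
          have "\<psi> \<beta> \<le> \<psi> \<epsilon>"
            using supp_e'[OF \<beta>]
          proof
            assume "\<beta> \<in> supp e"
            then show ?thesis using \<epsilon>(2) fin by simp
          next
            assume "\<exists>\<alpha>\<in>supp c. \<beta> = \<epsilon> - \<delta> + \<alpha>"
            then obtain \<alpha> where \<alpha>: "\<alpha> \<in> supp c" "\<beta> = \<epsilon> - \<delta> + \<alpha>" by blast
            then have "\<psi> \<beta> = \<psi> (\<epsilon> - \<delta>) + \<psi> \<alpha>"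
              using \<psi>(1) G(1) suppA(1) unfolding additive_on_def by blast
            moreover have "\<psi> (\<epsilon> - \<delta>) = \<psi> \<epsilon> - \<psi> \<delta>" by (rule additive_on_diff[OF A \<psi>(1) AA])
            ultimately have "\<psi> \<beta> = \<psi> \<epsilon> + (\<psi> \<alpha> - \<psi> \<delta>)" by simp
            moreover have "\<psi> \<alpha> \<le> \<psi> \<delta>" using \<delta>(2) \<alpha>(1) finite_supp[OF c(1)] by simp
            ultimately show ?thesis by simp
          qed
          moreover have "\<psi> \<beta> \<noteq> \<psi> \<epsilon>"
          proof
            assume "\<psi> \<beta> = \<psi> \<epsilon>"
            then have "\<beta> = \<epsilon>" using inj_onD[OF \<psi>(2)] \<beta> \<open>supp e' \<subseteq> S\<close> AA(1) unfolding S_def by blast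
            moreover have "hcomp e' \<epsilon> = 0"
              using \<delta>(1) unfolding hcomp_e' u_def by (simp add: supp_def)
            ultimately show False using \<beta> by (simp add: supp_def)
          qed
          ultimately show ?thesis by simp
        qed
        moreover have "finite (supp e')" "supp e' \<noteq> {}"
          using finite_supp supp_empty e'T that by auto
        ultimately have lt: "Max (\<psi> ` supp e') < \<psi> \<epsilon>" by (subst Max_less_iff) auto
        moreover have "\<epsilon> \<in> S" using \<epsilon>(1) e(2) by blast
        ultimately have "\<epsilon> \<in> {\<alpha> \<in> S. \<psi> \<alpha> \<le> Max (\<psi> ` supp e)} - {\<alpha> \<in> S. \<psi> \<alpha> \<le> Max (\<psi> ` supp e')}"
          using \<epsilon>(2) by auto
        moreover have "{\<alpha> \<in> S. \<psi> \<alpha> \<le> Max (\<psi> ` supp e')} \<subseteq> {\<alpha> \<in> S. \<psi> \<alpha> \<le> Max (\<psi> ` supp e)}"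
          using lt \<epsilon>(2) by auto
        ultimately show "{\<alpha> \<in> S. \<psi> \<alpha> \<le> Max (\<psi> ` supp e')} \<subset> {\<alpha> \<in> S. \<psi> \<alpha> \<le> Max (\<psi> ` supp e)}"
          by blast
      qed
      ultimately have "e' / c \<in> T"
        using less.hyps[of e'] e'T zero_T by (cases "e' = 0") auto
      from T_add[OF this uT] show ?thesis unfolding e'c by simp
    qed
  qed
  have "supp (c * x) \<subseteq> S"
    unfolding S_def B_def using suppA(2) finite_supp[OF cx] by (auto intro!: Max_ge)
  then have "c * x / c \<in> T" using x c by (intro main cx) auto
  then show ?thesis using c by simp
qed

end

section \<open>The homogeneous localization\<close>

lemma scale_span_subset_range:
  assumes "\<And>b. b \<in> B \<Longrightarrow> to_fract s * b \<in> range to_fract"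
  shows "fract_scale s ` fract.span B \<subseteq> range to_fract"
proof -
  have "fract_scale s y \<in> range to_fract" if "y \<in> fract.span B" for y
    using that
  proof (induction y rule: fract.span_induct_alt)
    case base
    then show ?case by (auto simp: fract_scale_def intro: range_eqI[of _ _ 0])
  next
    case (step r b y)
    then obtain p q where "to_fract s * b = to_fract p" "to_fract s * y = to_fract q"
      using assms unfolding fract_scale_def by blast
    then have "fract_scale s (fract_scale r b + y) = to_fract (r * p + q)"
      by (simp add: fract_scale_def distrib_left mult.left_commute[of _ "to_fract r"])
    then show ?case by blast
  qed
  then show ?thesis by blast
qed

locale graded_integral_domain =
  fixes \<Gamma> :: "'g::ab_group_add set" and Rc :: "'g \<Rightarrow> 'r::idom set"
  assumes monoid: "grading_monoid \<Gamma>" and domain: "graded_domain \<Gamma> Rc"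
begin

section \<open>Degrees, homogeneous fractions and common denominators\<close>

lemma monoid_0: "0 \<in> \<Gamma>" and monoid_add: "\<alpha> \<in> \<Gamma> \<Longrightarrow> \<beta> \<in> \<Gamma> \<Longrightarrow> \<alpha> + \<beta> \<in> \<Gamma>"
  using monoid unfolding grading_monoid_def by auto

lemma Rc_subgroup: "\<alpha> \<in> \<Gamma> \<Longrightarrow> additive_subgroup_of (Rc \<alpha>)"
  and Rc_mult: "\<alpha> \<in> \<Gamma> \<Longrightarrow> \<beta> \<in> \<Gamma> \<Longrightarrow> x \<in> Rc \<alpha> \<Longrightarrow> y \<in> Rc \<beta> \<Longrightarrow> x * y \<in> Rc (\<alpha> + \<beta>)"
  using domain unfolding graded_domain_def by auto

abbreviation "G \<equiv> quotient_group \<Gamma>"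
abbreviation "C \<equiv> localization_component \<Gamma> Rc"

lemma Rc_0: "\<alpha> \<in> \<Gamma> \<Longrightarrow> 0 \<in> Rc \<alpha>"
  using additive_subgroup_of_0[OF Rc_subgroup] .

lemma Rc_decomposition:
  obtains f where "f \<in> finite_families \<Gamma> Rc" "r = (\<Sum>i | f i \<noteq> 0. f i)"
  using domain unfolding graded_domain_def is_direct_sum_def bij_betw_def by blast

lemma Rc_independent:
  assumes "f \<in> finite_families \<Gamma> Rc" "(\<Sum>i | f i \<noteq> 0. f i) = 0"
  shows "f = (\<lambda>_. 0)"
proof -
  have "(\<lambda>_. 0) \<in> finite_families \<Gamma> Rc" using Rc_0 by (auto simp: finite_families_def)
  moreover have "inj_on (\<lambda>f. \<Sum>i | f i \<noteq> 0. f i) (finite_families \<Gamma> Rc)"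
    using domain unfolding graded_domain_def is_direct_sum_def bij_betw_def by blast
  ultimately show ?thesis using assms by (elim inj_onD) auto
qed

lemma ex_homogeneous: "\<exists>\<sigma>\<in>\<Gamma>. \<exists>s\<in>Rc \<sigma>. s \<noteq> 0"
proof (rule ccontr)
  assume *: "\<not> ?thesis"
  obtain f where f: "f \<in> finite_families \<Gamma> Rc" "1 = (\<Sum>i | f i \<noteq> 0. f i)"
    by (rule Rc_decomposition)
  then have "f i = 0" for i using * by (cases "i \<in> \<Gamma>") (auto simp: finite_families_def)
  then show False using f(2) by simp
qed

lemma monoid_subset_G: "\<Gamma> \<subseteq> G"
  unfolding quotient_group_def using monoid_0 by (force intro: exI[of _ 0])

lemma subgroup_quotient_group: "additive_subgroup_of G"
  unfolding additive_subgroup_of_def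
proof (intro conjI ballI)
  show "0 \<in> G" using monoid_0 monoid_subset_G by blast
  fix x y assume "x \<in> G" "y \<in> G"
  then obtain a b c d where "a \<in> \<Gamma>" "b \<in> \<Gamma>" "c \<in> \<Gamma>" "d \<in> \<Gamma>" "x = a - b" "y = c - d"
    unfolding quotient_group_def by blast
  then have "x - y = (a + d) - (b + c)" "a + d \<in> \<Gamma>" "b + c \<in> \<Gamma>"
    by (auto simp: monoid_add algebra_simps)
  then show "x - y \<in> G" unfolding quotient_group_def by blast
qed

lemma torsion_free_quotient_group: "torsion_free G"
  unfolding torsion_free_def
proof (intro allI ballI impI)
  fix n :: nat and x assume x: "x \<in> G" and n: "n \<ge> 1 \<and> (\<Sum>i<n. x) = 0"
  obtain a b where ab: "a \<in> \<Gamma>" "b \<in> \<Gamma>" "x = a - b" using x unfolding quotient_group_def by blast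
  then have "(\<Sum>i<n. a) = (\<Sum>i<n. b)" using n by (simp add: sum_subtractf)
  then have "a = b" using ab n monoid unfolding grading_monoid_def by blast
  then show "x = 0" using ab by simp
qed

lemma component_cases:
  assumes "x \<in> C \<alpha>"
  obtains "x = 0"
  | a b \<beta> \<gamma> where "x = Fract a b" "\<beta> \<in> \<Gamma>" "\<gamma> \<in> \<Gamma>" "a \<in> Rc \<beta>" "b \<in> Rc \<gamma>" "b \<noteq> 0" "\<alpha> = \<beta> - \<gamma>"
  using assms unfolding localization_component_def by blast

lemma FractI:
  "\<beta> \<in> \<Gamma> \<Longrightarrow> \<gamma> \<in> \<Gamma> \<Longrightarrow> a \<in> Rc \<beta> \<Longrightarrow> b \<in> Rc \<gamma> \<Longrightarrow> b \<noteq> 0 \<Longrightarrow> \<alpha> = \<beta> - \<gamma> \<Longrightarrow> Fract a b \<in> C \<alpha>"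
  unfolding localization_component_def by blast

lemma zero_component: "0 \<in> C \<alpha>"
  by (simp add: localization_component_def)

text \<open>The denominators are multiplied together. The alternative \<open>r = 0\<close> accounts
  for zero lying in every \<open>C \<alpha>\<close>, even where \<open>deg i + \<sigma>\<close> is
  outside \<open>\<Gamma>\<close>.\<close>

lemma common_denominator:
  assumes "finite I" "\<And>i. i \<in> I \<Longrightarrow> f i \<in> C (deg i)"
  shows "\<exists>\<sigma>\<in>\<Gamma>. \<exists>s\<in>Rc \<sigma>. s \<noteq> 0 \<and> (\<forall>i\<in>I. \<exists>r. to_fract s * f i = to_fract r \<and>
    (r = 0 \<or> deg i + \<sigma> \<in> \<Gamma> \<and> r \<in> Rc (deg i + \<sigma>)))"
  using assms
proof (induction I)
  case empty
  then show ?case using ex_homogeneous by simp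
next
  case (insert j I)
  then obtain \<sigma> s where s: "\<sigma> \<in> \<Gamma>" "s \<in> Rc \<sigma>" "s \<noteq> 0"
    and old: "\<And>i. i \<in> I \<Longrightarrow> \<exists>r. to_fract s * f i = to_fract r \<and>
      (r = 0 \<or> deg i + \<sigma> \<in> \<Gamma> \<and> r \<in> Rc (deg i + \<sigma>))"
    by (metis insertCI)
  have "f j \<in> C (deg j)" using insert by simp
  then show ?case
  proof (cases rule: component_cases)
    case 1
    then show ?thesis using s old by (intro bexI[of _ \<sigma>] bexI[of _ s]) auto
  next
    case (2 a b \<beta> \<gamma>)
    have "\<exists>r. to_fract (s * b) * f i = to_fract r \<and>
      (r = 0 \<or> deg i + (\<sigma> + \<gamma>) \<in> \<Gamma> \<and> r \<in> Rc (deg i + (\<sigma> + \<gamma>)))" if i: "i \<in> insert j I" for i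
    proof (cases "i = j")
      case True
      have "to_fract (s * b) * f i = to_fract (s * a)"
        using 2 True by (simp add: Fract_conv_to_fract)
      moreover have "deg i + (\<sigma> + \<gamma>) = \<sigma> + \<beta>" using 2 True by (simp add: algebra_simps)
      ultimately show ?thesis using Rc_mult[OF s(1) 2(2) s(2) 2(4)] monoid_add[OF s(1) 2(2)] by metis
    next
      case False
      then obtain r where r: "to_fract s * f i = to_fract r"
        "r = 0 \<or> deg i + \<sigma> \<in> \<Gamma> \<and> r \<in> Rc (deg i + \<sigma>)"
        using old i by blast
      have "to_fract (s * b) * f i = to_fract (r * b)" using r(1) by (simp add: ac_simps)
      moreover have "r * b = 0 \<or> deg i + \<sigma> + \<gamma> \<in> \<Gamma> \<and> r * b \<in> Rc (deg i + \<sigma> + \<gamma>)"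
        using r(2) Rc_mult[OF _ 2(3) _ 2(5)] monoid_add[OF _ 2(3)] by auto
      ultimately show ?thesis unfolding add.assoc by blast
    qed
    then show ?thesis
      using Rc_mult[OF s(1) 2(3) s(2) 2(5)] monoid_add[OF s(1) 2(3)] s(3) 2(6)
      by (intro bexI[of _ "\<sigma> + \<gamma>"] bexI[of _ "s * b"]) auto
  qed
qed

lemma divide_component:
  assumes "\<sigma> \<in> \<Gamma>" "s \<in> Rc \<sigma>" "s \<noteq> 0" "to_fract s * x = to_fract r"
    "r = 0 \<or> \<alpha> + \<sigma> \<in> \<Gamma> \<and> r \<in> Rc (\<alpha> + \<sigma>)"
  shows "x \<in> C \<alpha>"
proof -
  have x: "x = Fract r s" using assms by (simp add: Fract_conv_to_fract field_simps)
  show ?thesis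
  proof (cases "r = 0")
    case True
    then have "x = 0" unfolding x by (simp add: Fract_conv_to_fract)
    then show ?thesis by (simp add: zero_component)
  next
    case False
    then show ?thesis unfolding x using assms by (intro FractI[of "\<alpha> + \<sigma>" \<sigma>]) auto
  qed
qed

lemma graded_field_localization: "graded_field G C"
proof
  show "additive_subgroup_of G" "torsion_free G"
    by (rule subgroup_quotient_group torsion_free_quotient_group)+
  fix \<alpha> assume \<alpha>: "\<alpha> \<in> G"
  show "additive_subgroup_of (C \<alpha>)"
    unfolding additive_subgroup_of_def
  proof (intro conjI ballI)
    fix x y assume xy: "x \<in> C \<alpha>" "y \<in> C \<alpha>"
    from common_denominator[of "{x, y}" id "\<lambda>_. \<alpha>"] xy obtain \<sigma> s where
      s: "\<sigma> \<in> \<Gamma>" "s \<in> Rc \<sigma>" "s \<noteq> 0" and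
      ex: "\<forall>z\<in>{x, y}. \<exists>r. to_fract s * z = to_fract r \<and> (r = 0 \<or> \<alpha> + \<sigma> \<in> \<Gamma> \<and> r \<in> Rc (\<alpha> + \<sigma>))"
      by auto
    then obtain p q where p: "to_fract s * x = to_fract p" "p = 0 \<or> \<alpha> + \<sigma> \<in> \<Gamma> \<and> p \<in> Rc (\<alpha> + \<sigma>)"
      and q: "to_fract s * y = to_fract q" "q = 0 \<or> \<alpha> + \<sigma> \<in> \<Gamma> \<and> q \<in> Rc (\<alpha> + \<sigma>)" by blast
    have "p - q = 0 \<or> \<alpha> + \<sigma> \<in> \<Gamma> \<and> p - q \<in> Rc (\<alpha> + \<sigma>)"
      using p(2) q(2) additive_subgroup_of_diff[OF Rc_subgroup] additive_subgroup_of_uminus[OF Rc_subgroup]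
      by auto
    then show "x - y \<in> C \<alpha>"
      using p(1) q(1) by (intro divide_component[OF s, of _ "p - q"]) (auto simp: right_diff_distrib)
  qed (rule zero_component)
  show "inverse x \<in> C (- \<alpha>)" if "x \<in> C \<alpha>" for x
    using that
  proof (cases rule: component_cases)
    case (2 a b \<beta> \<gamma>)
    then show ?thesis
      by (cases "a = 0") (auto simp: zero_component Fract_conv_to_fract[of 0]
          Fract_conv_to_fract[of _ 0] intro!: FractI[of \<gamma> \<beta>])
  qed (simp add: zero_component)
  show "x * y \<in> C (\<alpha> + \<beta>)" if \<beta>: "\<beta> \<in> G" and x: "x \<in> C \<alpha>" and y: "y \<in> C \<beta>" for x y \<beta>
    using x
  proof (cases rule: component_cases)
    case x: (2 a b \<gamma> \<delta>)
    from y show ?thesis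
    proof (cases rule: component_cases)
      case (2 a' b' \<gamma>' \<delta>')
      have "Fract (a * a') (b * b') \<in> C (\<alpha> + \<beta>)"
        by (rule FractI[OF monoid_add[OF x(2) 2(2)] monoid_add[OF x(3) 2(3)]
              Rc_mult[OF x(2) 2(2) x(4) 2(4)] Rc_mult[OF x(3) 2(3) x(5) 2(5)]])
          (use x 2 in auto)
      then show ?thesis using x(1) 2(1) by simp
    qed (simp add: zero_component)
  qed (simp add: zero_component)
next
  fix S f \<gamma> assume S: "finite S" "S \<subseteq> G" and f: "\<And>\<alpha>. \<alpha> \<in> S \<Longrightarrow> f \<alpha> \<in> C \<alpha>"
    and sum: "sum f S = 0" and \<gamma>: "\<gamma> \<in> S"
  from common_denominator[OF S(1), of f id] f obtain \<sigma> s where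
    s: "\<sigma> \<in> \<Gamma>" "s \<in> Rc \<sigma>" "s \<noteq> 0" and
    ex: "\<forall>\<alpha>\<in>S. \<exists>r. to_fract s * f \<alpha> = to_fract r \<and> (r = 0 \<or> \<alpha> + \<sigma> \<in> \<Gamma> \<and> r \<in> Rc (\<alpha> + \<sigma>))"
    by auto
  then obtain r where r: "\<And>\<alpha>. \<alpha> \<in> S \<Longrightarrow> to_fract s * f \<alpha> = to_fract (r \<alpha>)"
    "\<And>\<alpha>. \<alpha> \<in> S \<Longrightarrow> r \<alpha> = 0 \<or> \<alpha> + \<sigma> \<in> \<Gamma> \<and> r \<alpha> \<in> Rc (\<alpha> + \<sigma>)" by metis
  \<comment> \<open>The numerators, shifted by the degree \<sigma> of the denominator, form a family
    over \<open>\<Gamma>\<close>, to which directness of the grading of \<open>R\<close>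
    applies.\<close>
  define h where "h \<beta> = (if \<beta> - \<sigma> \<in> S then r (\<beta> - \<sigma>) else 0)" for \<beta>
  have supp_h: "{\<beta>. h \<beta> \<noteq> 0} \<subseteq> (\<lambda>\<alpha>. \<alpha> + \<sigma>) ` S"
  proof
    fix \<beta> assume "\<beta> \<in> {\<beta>. h \<beta> \<noteq> 0}"
    then have "\<beta> - \<sigma> \<in> S" by (auto simp: h_def split: if_splits)
    then show "\<beta> \<in> (\<lambda>\<alpha>. \<alpha> + \<sigma>) ` S" by (force simp: image_iff)
  qed
  have "h \<in> finite_families \<Gamma> Rc"
    unfolding finite_families_def mem_Collect_eq
  proof (intro conjI ballI allI impI)
    show "finite {i. h i \<noteq> 0}" using supp_h S(1) by (meson finite_imageI finite_subset)
    show "h i \<in> Rc i" if "i \<in> \<Gamma>" for i using that r(2)[of "i - \<sigma>"] Rc_0 by (auto simp: h_def)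
    show "h i = 0" if "i \<notin> \<Gamma>" for i using that r(2)[of "i - \<sigma>"] by (auto simp: h_def)
  qed
  moreover have "(\<Sum>i | h i \<noteq> 0. h i) = 0"
  proof -
    have "(\<Sum>i | h i \<noteq> 0. h i) = sum h ((\<lambda>\<alpha>. \<alpha> + \<sigma>) ` S)"
      using S(1) supp_h by (intro sum.mono_neutral_left) auto
    also have "\<dots> = sum r S" by (subst sum.reindex) (auto simp: h_def)
    finally have "to_fract (\<Sum>i | h i \<noteq> 0. h i) = (\<Sum>\<alpha>\<in>S. to_fract s * f \<alpha>)" using r(1) by simp
    also have "\<dots> = 0" using sum by (simp flip: sum_distrib_left)
    finally show ?thesis by (simp only: to_fract_eq_0_iff)
  qed
  ultimately have "h = (\<lambda>_. 0)" by (rule Rc_independent)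
  then have "h (\<gamma> + \<sigma>) = 0" by simp
  then have "to_fract s * f \<gamma> = 0" using r(1) \<gamma> by (simp add: h_def)
  then show "f \<gamma> = 0" using s by simp
qed

sublocale graded_field G C
  by (rule graded_field_localization)

text \<open>Multiplication by \<open>s\<close> shifts degrees by \<sigma>, so the components of
  \<open>y\<close> are those of its numerator divided by \<open>s\<close>. This links the grading of
  \<open>R\<close> with that of \<open>T\<close>.\<close>

lemma hcomp_divide:
  assumes f: "f \<in> finite_families \<Gamma> Rc" and s: "\<sigma> \<in> \<Gamma>" "s \<in> Rc \<sigma>" "s \<noteq> 0"
    and y: "to_fract s * y = to_fract (\<Sum>i | f i \<noteq> 0. f i)"
  shows "y \<in> T" and "to_fract s * hcomp y (\<alpha> - \<sigma>) = to_fract (f \<alpha>)"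
proof -
  define h where "h \<beta> = to_fract (f (\<beta> + \<sigma>)) / to_fract s" for \<beta>
  let ?S = "(\<lambda>\<alpha>. \<alpha> - \<sigma>) ` {i. f i \<noteq> 0}"
  have S: "finite ?S" "?S \<subseteq> G" using f s(1) unfolding finite_families_def quotient_group_def by auto
  have h: "h \<beta> \<in> C \<beta>" if "\<beta> \<in> ?S" for \<beta>
    using that f s by (intro divide_component[OF s, of _ "f (\<beta> + \<sigma>)"]) (auto simp: h_def finite_families_def)
  have "to_fract s * sum h ?S = to_fract (\<Sum>i | f i \<noteq> 0. f i)"
    using s(3) by (subst sum.reindex) (auto simp: h_def sum_distrib_left inj_on_def)
  then have "sum h ?S = y" using y s(3) by (metis mult_cancel_left to_fract_eq_0_iff)
  with sum_in_T[OF S h] show "y \<in> T" and "to_fract s * hcomp y (\<alpha> - \<sigma>) = to_fract (f \<alpha>)"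
    using s(3) by (auto simp: h_def image_iff)
qed

lemma to_fract_T: "to_fract r \<in> T"
  and hcomp_to_fract: "hcomp (to_fract r) \<alpha> \<in> range to_fract"
proof -
  \<comment> \<open>Writing \<open>r\<close> as \<open>s\<close> times \<open>r / s\<close> for an
    arbitrary homogeneous \<open>s\<close> avoids showing that \<open>1\<close> has degree
    \<open>0\<close>.\<close>
  obtain \<sigma> s where s: "\<sigma> \<in> \<Gamma>" "s \<in> Rc \<sigma>" "s \<noteq> 0" using ex_homogeneous by blast
  obtain f where f: "f \<in> finite_families \<Gamma> Rc" "r = (\<Sum>i | f i \<noteq> 0. f i)" by (rule Rc_decomposition)
  define y where "y = to_fract r / to_fract s"
  have y: "to_fract s * y = to_fract r" using s(3) by (simp add: y_def)
  have yT: "y \<in> T" and hy: "\<And>\<alpha>. to_fract s * hcomp y (\<alpha> - \<sigma>) = to_fract (f \<alpha>)"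
    using hcomp_divide[OF f(1) s, of y] y f(2) by auto
  have sC: "to_fract s \<in> C \<sigma>"
    using Rc_mult[OF s(1) s(1) s(2) s(2)] monoid_add[OF s(1) s(1)]
    by (intro divide_component[OF s, of _ "s * s"]) auto
  have \<sigma>: "\<sigma> \<in> G" using s(1) monoid_subset_G by blast
  show "to_fract r \<in> T" unfolding y[symmetric] by (intro T_mult(1) yT C_imp_T[OF \<sigma> sC])
  show "hcomp (to_fract r) \<alpha> \<in> range to_fract"
    unfolding y[symmetric] using hcomp_homogeneous_mult[OF \<sigma> sC yT] hy by simp
qed

lemma T_subset_localization: "T \<subseteq> homogeneous_localization \<Gamma> Rc"
proof
  fix y assume y: "y \<in> T"
  from common_denominator[OF finite_supp[OF y], of "hcomp y" id] hcomp_in_C_supp[OF y] obtain \<sigma> s where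
    s: "\<sigma> \<in> \<Gamma>" "s \<in> Rc \<sigma>" "s \<noteq> 0" and
    ex: "\<forall>\<alpha>\<in>supp y. \<exists>r. to_fract s * hcomp y \<alpha> = to_fract r"
    by (auto; blast)
  then obtain r where r: "\<And>\<alpha>. \<alpha> \<in> supp y \<Longrightarrow> to_fract s * hcomp y \<alpha> = to_fract (r \<alpha>)" by metis
  have "to_fract s * sum (hcomp y) (supp y) = to_fract (sum r (supp y))"
    using r by (simp add: sum_distrib_left)
  then have "y = Fract (sum r (supp y)) s"
    using s(3) sum_hcomp_supp[OF y] by (simp add: Fract_conv_to_fract field_simps)
  then show "y \<in> homogeneous_localization \<Gamma> Rc"
    using s unfolding homogeneous_localization_def homogeneous_elements_def by blast
qed

section \<open>Homogeneous fractional ideals\<close>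

lemma homogeneous_fractional_ideal_components:
  assumes "homogeneous_fractional_ideal \<Gamma> Rc E" "y \<in> E"
  shows "y \<in> T" and "hcomp y \<beta> \<in> E"
proof -
  from assms(1) obtain \<sigma> s I where s: "\<sigma> \<in> \<Gamma>" "s \<in> Rc \<sigma>" "s \<noteq> 0"
    and I: "homogeneous_ideal \<Gamma> Rc I" "fract_scale s ` E = to_fract ` I"
    unfolding homogeneous_fractional_ideal_def homogeneous_elements_def by blast
  from I(2) assms(2) obtain r where r: "r \<in> I" "to_fract s * y = to_fract r"
    unfolding fract_scale_def by blast
  from I(1) r(1) obtain f where f: "f \<in> finite_families \<Gamma> (\<lambda>\<alpha>. I \<inter> Rc \<alpha>)" "r = (\<Sum>i | f i \<noteq> 0. f i)"
    unfolding homogeneous_ideal_def is_direct_sum_def bij_betw_def by blast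
  have f': "f \<in> finite_families \<Gamma> Rc" using f(1) unfolding finite_families_def by blast
  show "y \<in> T" by (rule hcomp_divide(1)[OF f' s]) (use r f in simp)
  have *: "to_fract s * hcomp y \<beta> = to_fract (f (\<beta> + \<sigma>))"
    using hcomp_divide(2)[OF f' s, of y "\<beta> + \<sigma>"] r f by simp
  show "hcomp y \<beta> \<in> E"
  proof (cases "\<beta> + \<sigma> \<in> \<Gamma>")
    case True
    then have "to_fract (f (\<beta> + \<sigma>)) \<in> fract_scale s ` E"
      unfolding I(2) using f(1) unfolding finite_families_def by blast
    then obtain z where "z \<in> E" "to_fract s * hcomp y \<beta> = to_fract s * z"
      unfolding fract_scale_def * by blast
    then show ?thesis using s(3) by simp
  next
    case False
    then have "to_fract s * hcomp y \<beta> = 0" unfolding * using f' by (simp add: finite_families_def)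
    then have "hcomp y \<beta> = 0" using s(3) by simp
    moreover have "fract.subspace E"
      using assms(1) unfolding homogeneous_fractional_ideal_def fractional_ideal_def by blast
    ultimately show ?thesis using fract.subspace_0 by simp
  qed
qed

text \<open>For \<open>b\<close> of degree \<alpha>, the component of \<open>r b\<close> in degree
  \<beta> is \<open>b\<close> times the component of \<open>r\<close> in degree \<beta> - \<alpha>,
  and the latter lies in \<open>R\<close>.\<close>

lemma span_components:
  assumes B: "B \<subseteq> (\<Union>\<alpha>\<in>G. C \<alpha>)" and y: "y \<in> fract.span B"
  shows "y \<in> T \<and> (\<forall>\<beta>. hcomp y \<beta> \<in> fract.span B)"
  using y
proof (induction y rule: fract.span_induct_alt)
  case base
  then show ?case by (simp add: zero_T fract.span_zero)
next
  case (step r b y)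
  then obtain \<alpha> where \<alpha>: "\<alpha> \<in> G" "b \<in> C \<alpha>" using B by blast
  have eq: "fract_scale r b = b * to_fract r" by (simp add: fract_scale_def)
  have T: "b * to_fract r \<in> T" by (intro T_mult(1) to_fract_T C_imp_T[OF \<alpha>])
  have "hcomp (b * to_fract r) \<beta> \<in> fract.span B" for \<beta>
  proof -
    obtain r' where r': "hcomp (to_fract r) (\<beta> - \<alpha>) = to_fract r'" using hcomp_to_fract by blast
    have "hcomp (b * to_fract r) \<beta> = fract_scale r' b"
      using hcomp_homogeneous_mult[OF \<alpha> to_fract_T] r' by (simp add: fract_scale_def)
    then show ?thesis using step fract.span_base fract.span_scale by metis
  qed
  then show ?case unfolding eq using step T by (auto simp: hcomp_add T_add fract.span_add)
qed

lemma homogeneous_fractional_ideal_span: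
  assumes B: "finite B" "B \<subseteq> (\<Union>\<alpha>\<in>G. C \<alpha>)"
  shows "homogeneous_fractional_ideal \<Gamma> Rc (fract.span B)"
proof -
  obtain deg where deg: "\<And>b. b \<in> B \<Longrightarrow> b \<in> C (deg b)" using B(2) by (metis UN_E subsetD)
  from common_denominator[OF B(1), of id deg] deg obtain \<sigma> s where
    s: "\<sigma> \<in> \<Gamma>" "s \<in> Rc \<sigma>" "s \<noteq> 0" and
    ex: "\<forall>b\<in>B. to_fract s * b \<in> range to_fract"
    by (auto; blast)
  have range: "fract_scale s ` fract.span B \<subseteq> range to_fract"
    using ex by (intro scale_span_subset_range) blast
  \<comment> \<open>The integral ideal demanded by the definition: the elements of \<open>R\<close>
    lying in \<open>s\<close> times the span.\<close>
  define I where "I = {r. to_fract r \<in> fract_scale s ` fract.span B}"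
  have I_iff: "r \<in> I \<longleftrightarrow> to_fract r / to_fract s \<in> fract.span B" for r
  proof
    assume "r \<in> I"
    then obtain y where "y \<in> fract.span B" "to_fract r = to_fract s * y"
      unfolding I_def fract_scale_def by blast
    then show "to_fract r / to_fract s \<in> fract.span B" using s(3) by simp
  next
    assume "to_fract r / to_fract s \<in> fract.span B"
    then show "r \<in> I" unfolding I_def fract_scale_def using s(3)
      by (auto intro: image_eqI[of _ _ "to_fract r / to_fract s"])
  qed
  interpret R: module "(*) :: 'r \<Rightarrow> 'r \<Rightarrow> 'r"
    by unfold_locales (simp_all add: algebra_simps)
  have "ring_ideal I"
    unfolding ring_ideal_def R.subspace_def
  proof (intro conjI ballI allI)
    fix x y c assume x: "x \<in> I"
    show "c * x \<in> I" using x fract.span_scale[of "to_fract x / to_fract s" B c]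
      unfolding I_iff fract_scale_def by simp
    assume "y \<in> I"
    with x show "x + y \<in> I" unfolding I_iff by (simp add: add_divide_distrib fract.span_add)
  qed (simp add: I_iff fract.span_zero)
  moreover have "is_direct_sum I \<Gamma> (\<lambda>\<alpha>. I \<inter> Rc \<alpha>)"
    unfolding is_direct_sum_def bij_betw_def
  proof
    let ?F = "finite_families \<Gamma> (\<lambda>\<alpha>. I \<inter> Rc \<alpha>)"
    have sub: "?F \<subseteq> finite_families \<Gamma> Rc" unfolding finite_families_def by blast
    then show "inj_on (\<lambda>f. \<Sum>i | f i \<noteq> 0. f i) ?F"
      using domain unfolding graded_domain_def is_direct_sum_def bij_betw_def
      by (auto intro: inj_on_subset)
    show "(\<lambda>f. \<Sum>i | f i \<noteq> 0. f i) ` ?F = I"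
    proof
      show "(\<lambda>f. \<Sum>i | f i \<noteq> 0. f i) ` ?F \<subseteq> I"
      proof (intro image_subsetI R.subspace_sum[OF \<open>ring_ideal I\<close>[unfolded ring_ideal_def]])
        fix f i assume "f \<in> ?F" "i \<in> {i. f i \<noteq> 0}"
        then show "f i \<in> I" by (cases "i \<in> \<Gamma>") (auto simp: finite_families_def)
      qed
      show "I \<subseteq> (\<lambda>f. \<Sum>i | f i \<noteq> 0. f i) ` ?F"
      proof
        fix r assume r: "r \<in> I"
        obtain f where f: "f \<in> finite_families \<Gamma> Rc" "r = (\<Sum>i | f i \<noteq> 0. f i)"
          by (rule Rc_decomposition)
        let ?y = "to_fract r / to_fract s"
        have "to_fract (f \<alpha>) / to_fract s = hcomp ?y (\<alpha> - \<sigma>)" for \<alpha>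
          using hcomp_divide(2)[OF f(1) s, of ?y \<alpha>] s(3) f(2) by (simp add: field_simps)
        then have "f \<alpha> \<in> I" for \<alpha>
          using span_components[OF B(2)] r unfolding I_iff by simp
        then have "f \<in> ?F" using f(1) by (auto simp: finite_families_def)
        then show "r \<in> (\<lambda>f. \<Sum>i | f i \<noteq> 0. f i) ` ?F" using f(2) by blast
      qed
    qed
  qed
  moreover have "fract_scale s ` fract.span B = to_fract ` I"
  proof
    show "fract_scale s ` fract.span B \<subseteq> to_fract ` I"
    proof
      fix y assume y: "y \<in> fract_scale s ` fract.span B"
      then obtain r where "y = to_fract r" using range by blast
      then show "y \<in> to_fract ` I" using y by (simp add: I_def)
    qed
    show "to_fract ` I \<subseteq> fract_scale s ` fract.span B"
      unfolding I_def by (rule image_subsetI) simp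
  qed
  moreover have "fractional_ideal (fract.span B)"
    unfolding fractional_ideal_def using range s(3) fract.subspace_span by blast
  moreover have "s \<in> homogeneous_elements \<Gamma> Rc"
    unfolding homogeneous_elements_def using s by blast
  ultimately show ?thesis
    unfolding homogeneous_fractional_ideal_def homogeneous_ideal_def by blast
qed

end

section \<open>Semistar operations\<close>

lemma span_mult_span:
  assumes "x \<in> fract.span A" "y \<in> fract.span B"
  shows "x * y \<in> fract.span (A * B)"
  using assms(1)
proof (induction x rule: fract.span_induct_alt)
  case base
  then show ?case by (simp add: fract.span_zero)
next
  case (step r a x)
  have "a * y \<in> fract.span (A * B)"
    using assms(2)
  proof (induction y rule: fract.span_induct_alt)
    case base
    then show ?case by (simp add: fract.span_zero)
  next
    case (step s b y)
    have "a * (fract_scale s b + y) = fract_scale s (a * b) + a * y"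
      by (simp add: fract_scale_def algebra_simps)
    then show ?case
      using step \<open>a \<in> A\<close> by (simp add: fract.span_add fract.span_scale fract.span_base set_times_intro)
  qed
  moreover have "(fract_scale r a + x) * y = fract_scale r (a * y) + x * y"
    by (simp add: fract_scale_def algebra_simps)
  ultimately show ?case using step by (simp add: fract.span_add fract.span_scale)
qed

text \<open>Reduces products of modules to products of generating sets, the form in which
  \<open>star_a\<close> is handled from here on.\<close>

lemma module_product_span: "module_product (fract.span A) (fract.span B) = fract.span (A * B)"
proof
  show "module_product (fract.span A) (fract.span B) \<subseteq> fract.span (A * B)"
    unfolding module_product_def by (rule fract.span_minimal) (auto intro: span_mult_span)
  show "fract.span (A * B) \<subseteq> module_product (fract.span A) (fract.span B)"
    unfolding module_product_def
    by (rule fract.span_mono) (auto elim!: set_times_elim intro: fract.span_base)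
qed

lemma span_image_mult: "fract.span ((*) x ` B) = (*) x ` fract.span B"
proof -
  have "module_hom fract_scale fract_scale ((*) x)"
    by unfold_locales (simp_all add: fract_scale_def algebra_simps)
  then show ?thesis by (rule module_hom.span_image)
qed

section \<open>Finitely generated fractional ideals\<close>

lemma finite_common_denominator:
  assumes "finite B"
  obtains s where "s \<noteq> 0" "fract_scale s ` fract.span B \<subseteq> range to_fract"
proof -
  have "\<exists>s. s \<noteq> 0 \<and> (\<forall>b\<in>B. to_fract s * b \<in> range to_fract)"
    using assms
  proof (induction B)
    case (insert b B)
    then obtain s where s: "s \<noteq> 0" "\<And>b. b \<in> B \<Longrightarrow> to_fract s * b \<in> range to_fract" by blast
    obtain p q where b: "b = Fract p q" "q \<noteq> 0" by (rule Fract_cases)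
    have "to_fract (s * q) * b = to_fract (s * p)" using b by (simp add: Fract_conv_to_fract)
    moreover have "to_fract (s * q) * c \<in> range to_fract" if "c \<in> B" for c
    proof -
      obtain r where "to_fract s * c = to_fract r" using s(2)[OF \<open>c \<in> B\<close>] by blast
      then have "to_fract (s * q) * c = to_fract (r * q)" by (simp add: ac_simps)
      then show ?thesis by blast
    qed
    ultimately show ?case using s(1) b(2) by (intro exI[of _ "s * q"]) (auto simp del: to_fract_mult)
  qed (auto intro: exI[of _ 1])
  then show ?thesis using that scale_span_subset_range by blast
qed

lemma span_eq_0_iff: "fract.span B = {0} \<longleftrightarrow> B \<subseteq> {0}"
proof
  assume "B \<subseteq> {0}"
  then have "fract.span B \<subseteq> fract.span {}" by (intro fract.span_minimal) auto
  then show "fract.span B = {0}" using fract.span_zero[of B] by auto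
qed (use fract.span_superset in blast)

lemma fg_fractional_ideals_iff:
  "E \<in> fg_fractional_ideals \<longleftrightarrow> (\<exists>B. finite B \<and> \<not> B \<subseteq> {0} \<and> E = fract.span B)"
proof
  assume "E \<in> fg_fractional_ideals"
  then obtain B where "finite B" "E = fract.span B" "E \<noteq> {0}"
    by (auto simp: fg_fractional_ideals_def)
  moreover from this have "\<not> B \<subseteq> {0}" by (simp add: span_eq_0_iff)
  ultimately show "\<exists>B. finite B \<and> \<not> B \<subseteq> {0} \<and> E = fract.span B" by metis
next
  assume "\<exists>B. finite B \<and> \<not> B \<subseteq> {0} \<and> E = fract.span B"
  then obtain B where B: "finite B" "\<not> B \<subseteq> {0}" "E = fract.span B" by metis
  obtain s where "s \<noteq> 0" "fract_scale s ` E \<subseteq> range to_fract"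
    using finite_common_denominator[OF B(1)] unfolding B(3) .
  then have "fractional_ideal E" unfolding fractional_ideal_def by (auto simp: B(3))
  moreover have "E \<noteq> {0}" using B(2) unfolding B(3) by (simp add: span_eq_0_iff)
  ultimately show "E \<in> fg_fractional_ideals"
    unfolding fg_fractional_ideals_def using B(1,3) by auto
qed

section \<open>Semistar operations expressed through generating sets\<close>

locale semistar =
  fixes star :: "'r::idom fract set \<Rightarrow> 'r fract set"
  assumes semistar: "semistar_operation star"
begin

lemma span_nonzero: "\<not> B \<subseteq> {0} \<Longrightarrow> fract.span B \<in> nonzero_submodules"
  unfolding nonzero_submodules_def by (simp add: span_eq_0_iff)

lemmas star_axioms = semistar[unfolded semistar_operation_def]

lemma star_nonzero: "E \<in> nonzero_submodules \<Longrightarrow> star E \<in> nonzero_submodules"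
  using star_axioms[THEN conjunct1] by simp

lemma star_scale:
  "x \<noteq> 0 \<Longrightarrow> E \<in> nonzero_submodules \<Longrightarrow> star ((*) x ` E) = (*) x ` star E"
  using star_axioms[THEN conjunct2, THEN conjunct1] by simp

lemma star_mono:
  "E \<in> nonzero_submodules \<Longrightarrow> F \<in> nonzero_submodules \<Longrightarrow> E \<subseteq> F \<Longrightarrow> star E \<subseteq> star F"
  using star_axioms[THEN conjunct2, THEN conjunct2, THEN conjunct1] by simp

lemma star_extensive: "E \<in> nonzero_submodules \<Longrightarrow> E \<subseteq> star E"
  using star_axioms[THEN conjunct2, THEN conjunct2, THEN conjunct2, THEN conjunct1] by simp

lemma star_star: "E \<in> nonzero_submodules \<Longrightarrow> star (star E) = star E"
  using star_axioms[THEN conjunct2, THEN conjunct2, THEN conjunct2, THEN conjunct2] by simp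

lemma subspace_star: "E \<in> nonzero_submodules \<Longrightarrow> fract.subspace (star E)"
  using star_nonzero[of E] by (simp add: nonzero_submodules_def)

lemma star_span_scale:
  "x \<noteq> 0 \<Longrightarrow> \<not> B \<subseteq> {0} \<Longrightarrow> star (fract.span ((*) x ` B)) = (*) x ` star (fract.span B)"
  unfolding span_image_mult by (intro star_scale span_nonzero)

text \<open>With \<open>B\<close> and \<open>D\<close> standing for their spans, \<open>x
  B\<^sup>\<star> = (x B)\<^sup>\<star> \<subseteq> (D\<^sup>\<star>)\<^sup>\<star> =
  D\<^sup>\<star>\<close>, so such inclusions can be tested on generators. The scaling axiom covers
  only \<open>x \<noteq> 0\<close>, whence the case distinction.\<close>

lemma star_span_mult:
  assumes D: "\<not> D \<subseteq> {0}" and B: "\<not> B \<subseteq> {0}" and x: "\<And>b. b \<in> B \<Longrightarrow> x * b \<in> star (fract.span D)"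
    and y: "y \<in> star (fract.span B)"
  shows "x * y \<in> star (fract.span D)"
proof (cases "x = 0")
  case True
  then show ?thesis using fract.subspace_0[OF subspace_star[OF span_nonzero[OF D]]] by simp
next
  case False
  have ne: "\<not> (*) x ` B \<subseteq> {0}" using B False by auto
  have "fract.span ((*) x ` B) \<subseteq> star (fract.span D)"
    using x by (intro fract.span_minimal subspace_star span_nonzero D) auto
  then have "star (fract.span ((*) x ` B)) \<subseteq> star (star (fract.span D))"
    by (intro star_mono span_nonzero star_nonzero ne D)
  then show ?thesis
    using y unfolding star_span_scale[OF False B] star_star[OF span_nonzero[OF D]] by blast
qed

text \<open>Together with \<open>star_aI\<close> this rephrases membership in \<open>star_a\<close>
  by finite sets. Here the colon condition on \<open>J\<^sup>\<star>\<close> is restricted to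
  generators of \<open>J\<close>; in the converse \<open>star_span_mult\<close> recovers it.\<close>

lemma star_aE:
  assumes "x \<in> star_a star E"
  obtains Q B where "finite Q" "Q \<subseteq> E" "\<not> Q \<subseteq> {0}" "finite B" "\<not> B \<subseteq> {0}"
    "\<And>b. b \<in> B \<Longrightarrow> x * b \<in> star (fract.span (Q * B))"
proof -
  from assms obtain F J where F: "F \<in> fg_fractional_ideals" "F \<subseteq> E" and J: "J \<in> fg_fractional_ideals"
    and x: "x \<in> module_colon (star (module_product F J)) (star J)"
    by (auto simp: star_a_def star_a_fg_def)
  from F(1) obtain Q where Q: "finite Q" "\<not> Q \<subseteq> {0}" "F = fract.span Q"
    unfolding fg_fractional_ideals_iff by metis
  from J obtain B where B: "finite B" "\<not> B \<subseteq> {0}" "J = fract.span B"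
    unfolding fg_fractional_ideals_iff by metis
  have "Q \<subseteq> E" using F(2) fract.span_superset[of Q] unfolding Q(3) by simp
  moreover have "b \<in> star J" if "b \<in> B" for b
    using subsetD[OF star_extensive[OF span_nonzero[OF B(2)]] fract.span_base[OF that]] B(3) by simp
  then have "x * b \<in> star (fract.span (Q * B))" if "b \<in> B" for b
    using x that unfolding module_colon_def Q(3) B(3) module_product_span by (auto simp: image_subset_iff)
  ultimately show ?thesis using that Q(1,2) B(1,2) by metis
qed

lemma star_aI:
  assumes E: "fract.subspace E" and Q: "finite Q" "Q \<subseteq> E" "\<not> Q \<subseteq> {0}"
    and B: "finite B" "\<not> B \<subseteq> {0}" and x: "\<And>b. b \<in> B \<Longrightarrow> x * b \<in> star (fract.span (Q * B))"
  shows "x \<in> star_a star E"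
proof -
  have "x * y \<in> star (fract.span (Q * B))" if "y \<in> star (fract.span B)" for y
    by (rule star_span_mult[OF set_times_nonzero[OF Q(3) B(2)] B(2) x that])
  then have "x \<in> module_colon (star (module_product (fract.span Q) (fract.span B))) (star (fract.span B))"
    unfolding module_colon_def module_product_span by (simp add: image_subset_iff)
  moreover have fg: "fract.span P \<in> fg_fractional_ideals" if "finite P" "\<not> P \<subseteq> {0}" for P :: "'r fract set"
    using that unfolding fg_fractional_ideals_iff by metis
  then have "fract.span B \<in> fg_fractional_ideals" "fract.span Q \<in> fg_fractional_ideals" using Q B by auto
  moreover have "fract.span Q \<subseteq> E" by (rule fract.span_minimal[OF Q(2) E])
  ultimately show ?thesis unfolding star_a_def star_a_fg_def by (intro UN_I CollectI conjI)
qed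

text \<open>\<open>Q \<union> Q'\<close> and \<open>B * B'\<close> are common witnesses: the
  relation for \<open>x\<close> is multiplied by an element of \<open>B'\<close>, that for
  \<open>y\<close> by an element of \<open>B\<close>, and both land in the closure of the same
  product.\<close>

lemma star_a_diff:
  assumes E: "fract.subspace E" and "x \<in> star_a star E" "y \<in> star_a star E"
  shows "x - y \<in> star_a star E"
proof -
  obtain Q B where Q: "finite Q" "Q \<subseteq> E" "\<not> Q \<subseteq> {0}" and B: "finite B" "\<not> B \<subseteq> {0}"
    and x: "\<And>b. b \<in> B \<Longrightarrow> x * b \<in> star (fract.span (Q * B))"
    by (rule star_aE[OF assms(2)]) (rule that)
  obtain Q' B' where Q': "finite Q'" "Q' \<subseteq> E" "\<not> Q' \<subseteq> {0}"
    and B': "finite B'" "\<not> B' \<subseteq> {0}"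
    and y: "\<And>b. b \<in> B' \<Longrightarrow> y * b \<in> star (fract.span (Q' * B'))"
    by (rule star_aE[OF assms(3)]) (rule that)
  let ?D = "(Q \<union> Q') * (B * B')"
  have BB': "\<not> B * B' \<subseteq> {0}" by (rule set_times_nonzero[OF B(2) B'(2)])
  have QQ': "\<not> Q \<union> Q' \<subseteq> {0}" using Q(3) by simp
  have D: "\<not> ?D \<subseteq> {0}" by (rule set_times_nonzero[OF QQ' BB'])
  have base: "z \<in> star (fract.span ?D)" if "z \<in> ?D" for z
    using subsetD[OF star_extensive[OF span_nonzero[OF D]] fract.span_base[OF that]] .
  have "(x - y) * c \<in> star (fract.span ?D)" if "c \<in> B * B'" for c
  proof -
    from that obtain b b' where c: "c = b * b'" "b \<in> B" "b' \<in> B'" by (rule set_times_elim)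
    have "b' * (x * b) \<in> star (fract.span ?D)"
    proof (rule star_span_mult[OF D set_times_nonzero[OF Q(3) B(2)] _ x[OF c(2)]])
      fix z assume "z \<in> Q * B"
      then obtain q d where "z = q * d" "q \<in> Q" "d \<in> B" by (rule set_times_elim)
      then have "b' * z = q * (d * b')" "q * (d * b') \<in> ?D" using c(3) by auto
      then show "b' * z \<in> star (fract.span ?D)" using base by metis
    qed
    moreover have "b * (y * b') \<in> star (fract.span ?D)"
    proof (rule star_span_mult[OF D set_times_nonzero[OF Q'(3) B'(2)] _ y[OF c(3)]])
      fix z assume "z \<in> Q' * B'"
      then obtain q d where "z = q * d" "q \<in> Q'" "d \<in> B'" by (rule set_times_elim)
      then have "b * z = q * (b * d)" "q * (b * d) \<in> ?D" using c(2) by auto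
      then show "b * z \<in> star (fract.span ?D)" using base by metis
    qed
    moreover have "(x - y) * c = b' * (x * b) - b * (y * b')" by (simp add: c algebra_simps)
    ultimately show ?thesis
      using fract.subspace_diff[OF subspace_star[OF span_nonzero[OF D]]] by metis
  qed
  then show ?thesis
    using Q(1,2) Q'(1,2) B(1) B'(1)
    by (intro star_aI[OF E _ _ QQ' _ BB']) (simp_all add: finite_set_times)
qed

end

section \<open>Homogeneity of the closure under \<open>star_a\<close>\<close>

locale homogeneous_preserving_semistar = graded_integral_domain + semistar +
  assumes preserving: "homogeneous_preserving \<Gamma> Rc star"
begin

text \<open>Finitely many homogeneous generators span a homogeneous fractional ideal, so the
  hypothesis on \<open>star\<close> applies; \<open>is_direct_sum_iff\<close> then yields the
  components.\<close>

lemma star_span_homogeneous: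
  assumes D: "finite D" "D \<subseteq> (\<Union>\<alpha>\<in>G. C \<alpha>)" "\<not> D \<subseteq> {0}" and y: "y \<in> star (fract.span D)"
  shows "y \<in> T" and "hcomp y \<alpha> \<in> star (fract.span D)"
proof -
  let ?M = "star (fract.span D)"
  have "is_direct_sum ?M G (\<lambda>\<alpha>. ?M \<inter> C \<alpha>)"
    using preserving homogeneous_fractional_ideal_span[OF D(1,2)] D(3)
    unfolding homogeneous_preserving_def span_eq_0_iff[symmetric] by blast
  moreover have "fract.subspace ?M" using subspace_star span_nonzero D(3) by blast
  then have "additive_subgroup_of ?M"
    unfolding additive_subgroup_of_def using fract.subspace_0 fract.subspace_diff by blast
  ultimately have "?M \<subseteq> T \<and> (\<forall>y\<in>?M. \<forall>\<alpha>. hcomp y \<alpha> \<in> ?M)" using is_direct_sum_iff by blast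
  then show "y \<in> T" "hcomp y \<alpha> \<in> ?M" using y by blast+
qed

lemma components_homogeneous: "J \<subseteq> T \<Longrightarrow> components J \<subseteq> (\<Union>\<alpha>\<in>G. C \<alpha>)"
proof
  fix z assume J: "J \<subseteq> T" and "z \<in> components J"
  then consider "z = 0" | a \<alpha> where "a \<in> J" "z = hcomp a \<alpha>" unfolding components_def by blast
  then show "z \<in> (\<Union>\<alpha>\<in>G. C \<alpha>)"
  proof cases
    case 1
    then show ?thesis using zero_component additive_subgroup_of_0[OF subgroup_G] by blast
  next
    case (2 a \<alpha>)
    show ?thesis
    proof (cases "\<alpha> \<in> supp a")
      case True
      then show ?thesis using 2 J hcomp_in_C_supp[of a] supp_subset[of a] by blast
    next
      case False
      then show ?thesis using 2 hcomp_outside[OF False] zero_component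
          additive_subgroup_of_0[OF subgroup_G] by auto
    qed
  qed
qed

lemma set_times_homogeneous:
  assumes "A \<subseteq> (\<Union>\<alpha>\<in>G. C \<alpha>)" "B \<subseteq> (\<Union>\<alpha>\<in>G. C \<alpha>)"
  shows "A * B \<subseteq> (\<Union>\<alpha>\<in>G. C \<alpha>)"
proof
  fix z assume "z \<in> A * B"
  then obtain a b where z: "z = a * b" "a \<in> A" "b \<in> B" by (rule set_times_elim)
  then obtain \<alpha> \<beta> where "\<alpha> \<in> G" "a \<in> C \<alpha>" "\<beta> \<in> G" "b \<in> C \<beta>" using assms by blast
  then show "z \<in> (\<Union>\<alpha>\<in>G. C \<alpha>)"
    using z(1) C_mult[of \<alpha> \<beta> a b] additive_subgroup_of_add[OF subgroup_G, of \<alpha> \<beta>] by auto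
qed

lemma components_nonzero: "J \<subseteq> T \<Longrightarrow> \<not> J \<subseteq> {0} \<Longrightarrow> \<not> components J \<subseteq> {0}"
proof -
  assume "J \<subseteq> T" "\<not> J \<subseteq> {0}"
  then obtain a where a: "a \<in> J" "a \<noteq> 0" "a \<in> T" by blast
  then obtain \<alpha> where "\<alpha> \<in> supp a" using supp_empty by blast
  then have "hcomp a \<alpha> \<noteq> 0" by (simp add: supp_def)
  then show ?thesis using hcomp_in_components[OF a(1)] by blast
qed

lemma in_span_components:
  assumes "a \<in> J" "a \<in> T"
  shows "a \<in> fract.span (components J)"
proof -
  have "sum (hcomp a) (supp a) \<in> fract.span (components J)"
    by (intro fract.span_sum fract.span_base hcomp_in_components assms)
  then show ?thesis using sum_hcomp_supp assms by simp
qed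

text \<open>Elements of \<open>D\<close> need not be homogeneous; their components span a larger
  module, to which \<open>star_span_homogeneous\<close> applies.\<close>

lemma star_span_subset_T:
  assumes D: "finite D" "D \<subseteq> T" "\<not> D \<subseteq> {0}"
  shows "star (fract.span D) \<subseteq> T"
proof -
  have "fract.span D \<subseteq> fract.span (components D)"
    using in_span_components D(2) by (intro fract.span_minimal) auto
  then have "star (fract.span D) \<subseteq> star (fract.span (components D))"
    by (intro star_mono span_nonzero components_nonzero D)
  then show ?thesis
    using star_span_homogeneous(1)[OF finite_components components_homogeneous components_nonzero] D
    by blast
qed

lemma star_a_homogeneous:
  assumes E: "homogeneous_fractional_ideal \<Gamma> Rc E" and x: "x \<in> star_a star E"
  shows "x \<in> T" and "hcomp x \<beta> \<in> star_a star E"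
proof -
  have sub: "fract.subspace E"
    using E unfolding homogeneous_fractional_ideal_def fractional_ideal_def by blast
  have ET: "E \<subseteq> T" using homogeneous_fractional_ideal_components[OF E] by blast
  obtain Q B0 where Q: "finite Q" "Q \<subseteq> E" "\<not> Q \<subseteq> {0}" and B0: "finite B0" "\<not> B0 \<subseteq> {0}"
    and x0: "\<And>b. b \<in> B0 \<Longrightarrow> x * b \<in> star (fract.span (Q * B0))"
    by (rule star_aE[OF x]) (rule that)
  obtain s where s: "s \<noteq> 0" "fract_scale s ` fract.span B0 \<subseteq> range to_fract"
    using finite_common_denominator[OF B0(1)] .
  \<comment> \<open>Scaling by a common denominator moves the generators into \<open>R\<close>,
    hence into \<open>T\<close>; the relation \<open>x B \<subseteq> (Q B)\<^sup>\<star>\<close> is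
    invariant under it.\<close>
  define B where "B = (*) (to_fract s) ` B0"
  have BT: "B \<subseteq> T"
  proof
    fix b assume "b \<in> B"
    then obtain b0 where "b0 \<in> B0" "b = fract_scale s b0" unfolding B_def fract_scale_def by auto
    then have "b \<in> fract_scale s ` fract.span B0" by (simp add: fract.span_base)
    then obtain r where "b = to_fract r" using s(2) by auto
    then show "b \<in> T" by (simp add: to_fract_T)
  qed
  have B: "finite B" "\<not> B \<subseteq> {0}" using B0 s(1) by (auto simp: B_def)
  have QT: "Q \<subseteq> T" using Q ET by blast
  have QB: "\<not> Q * B \<subseteq> {0}" by (rule set_times_nonzero[OF Q(3) B(2)])
  have xB: "x * b \<in> star (fract.span (Q * B))" if "b \<in> B" for b
  proof -
    from that obtain b0 where b0: "b = to_fract s * b0" "b0 \<in> B0" unfolding B_def by blast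
    have "to_fract s * (x * b0) \<in> star (fract.span (Q * B))"
    proof (rule star_span_mult[OF QB set_times_nonzero[OF Q(3) B0(2)] _ x0[OF b0(2)]])
      fix z assume "z \<in> Q * B0"
      then obtain q d where "z = q * d" "q \<in> Q" "d \<in> B0" by (rule set_times_elim)
      then have "to_fract s * z = q * (to_fract s * d)" "q * (to_fract s * d) \<in> Q * B"
        by (auto simp: B_def)
      then show "to_fract s * z \<in> star (fract.span (Q * B))"
        using star_extensive[OF span_nonzero[OF QB]] fract.span_superset by (metis subsetD)
    qed
    then show ?thesis by (simp add: b0 ac_simps)
  qed
  \<comment> \<open>\<open>z Q B\<close> stays in \<open>T\<close> because
    \<open>Q \<subseteq> E \<subseteq> T\<close>; so does \<open>(z Q B)\<^sup>\<star>\<close>,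
    which contains \<open>z x B\<close>. Iterating from \<open>z = 1\<close> reaches every power of
    \<open>x\<close>.\<close>
  have step: "z * x * b \<in> T" if z: "\<And>b. b \<in> B \<Longrightarrow> z * b \<in> T" and b: "b \<in> B" for z b
  proof (cases "z = 0")
    case True
    then show ?thesis using zero_T by simp
  next
    case False
    have "(*) z ` (Q * B) \<subseteq> T"
    proof
      fix y assume "y \<in> (*) z ` (Q * B)"
      then obtain w where "y = z * w" "w \<in> Q * B" by auto
      moreover from this(2) obtain q b where "w = q * b" "q \<in> Q" "b \<in> B" by (rule set_times_elim)
      ultimately have "y = q * (z * b)" "q \<in> Q" "b \<in> B" by simp_all
      then show "y \<in> T" using T_mult(1) z QT by blast
    qed
    then have "star (fract.span ((*) z ` (Q * B))) \<subseteq> T"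
      using False QB Q B by (intro star_span_subset_T) (auto simp: finite_set_times)
    then show ?thesis using xB[OF b] unfolding star_span_scale[OF False QB] by (auto simp: mult.assoc)
  qed
  have pow: "b \<in> B \<Longrightarrow> x ^ n * b \<in> T" for n b
  proof (induction n arbitrary: b)
    case 0
    then show ?case using BT by auto
  next
    case (Suc n)
    then show ?case using step[of "x ^ n" b] by (simp add: ac_simps)
  qed
  obtain b where b: "b \<in> B" "b \<noteq> 0" using B by blast
  show xT: "x \<in> T"
    using completely_integrally_closed[of b x] b BT pow by (auto simp: mult.commute)
  \<comment> \<open>\<open>dedekind_mertens\<close> asks for
    \<open>card (supp x) \<le> Suc n\<close>; this choice meets it without a subtraction.\<close>
  define n where "n = card (supp x)"
  define Q' P where "Q' = components Q" and "P = components B"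
  have Q': "finite Q'" "\<not> Q' \<subseteq> {0}" "Q' \<subseteq> E" "Q' \<subseteq> (\<Union>\<alpha>\<in>G. C \<alpha>)"
    unfolding Q'_def using Q QT finite_components components_nonzero components_homogeneous
      homogeneous_fractional_ideal_components(2)[OF E] fract.subspace_0[OF sub]
    by (auto simp: components_def subset_iff)
  have P: "finite P" "\<not> P \<subseteq> {0}" "P \<subseteq> (\<Union>\<alpha>\<in>G. C \<alpha>)"
    unfolding P_def using B BT finite_components components_nonzero components_homogeneous by auto
  have QP: "\<not> Q' * P \<subseteq> {0}" by (rule set_times_nonzero[OF Q'(2) P(2)])
  have "fract.span (Q * B) \<subseteq> fract.span (Q' * P)"
  proof (rule fract.span_minimal)
    show "Q * B \<subseteq> fract.span (Q' * P)"
    proof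
      fix z assume "z \<in> Q * B"
      then obtain q b where "z = q * b" "q \<in> Q" "b \<in> B" by (rule set_times_elim)
      then show "z \<in> fract.span (Q' * P)"
        unfolding Q'_def P_def using in_span_components QT BT by (auto intro!: span_mult_span)
    qed
  qed simp
  then have "star (fract.span (Q * B)) \<subseteq> star (fract.span (Q' * P))"
    by (intro star_mono span_nonzero QB QP)
  then have comp_xB: "hcomp (x * b) \<gamma> \<in> star (fract.span (Q' * P))" if "b \<in> B" for b \<gamma>
    using star_span_homogeneous(2)[OF finite_set_times[OF Q'(1) P(1)]
        set_times_homogeneous[OF Q'(4) P(3)] QP] xB[OF that] by blast
  \<comment> \<open>\<open>P ^ Suc n\<close> takes over the role of \<open>B\<close>: that its
    elements multiply the components of \<open>x\<close> into \<open>?M\<close> is the premise of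
    \<open>star_aI\<close>.\<close>
  let ?D = "Q' * P ^ Suc n"
  let ?M = "star (fract.span ?D)"
  have Pn: "\<not> P ^ Suc n \<subseteq> {0}" by (rule set_power_nonzero[OF P(2)])
  have D: "\<not> ?D \<subseteq> {0}" by (rule set_times_nonzero[OF Q'(2) Pn])
  have "additive_subgroup_of ?M"
    using subspace_star[OF span_nonzero[OF D]] fract.subspace_0 fract.subspace_diff
    unfolding additive_subgroup_of_def by blast
  \<comment> \<open>Elements of \<open>P ^ n\<close> multiply \<open>Q' * P\<close> into
    \<open>?D\<close>, hence by \<open>star_span_mult\<close> the closure of its span into
    \<open>?M\<close>; that closure contains the components of \<open>b * x\<close>.\<close>
  moreover have "q * hcomp (b * x) \<gamma> \<in> ?M" if q: "q \<in> components B ^ n" and b: "b \<in> B" for q b \<gamma>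
  proof -
    have "q * z \<in> ?M" if "z \<in> Q' * P" for z
    proof -
      from that obtain q' p where "z = q' * p" "q' \<in> Q'" "p \<in> P" by (rule set_times_elim)
      moreover from this have "q' * (p * q) \<in> ?D" using q unfolding P_def power_Suc by auto
      ultimately have "q * z = q' * (p * q)" "q' * (p * q) \<in> ?D" by simp_all
      then show ?thesis
        using star_extensive[OF span_nonzero[OF D]] fract.span_superset by (metis subsetD)
    qed
    then show ?thesis
      using star_span_mult[OF D QP] comp_xB[OF b] by (metis mult.commute)
  qed
  ultimately have "p * hcomp x \<beta> \<in> ?M" if "p \<in> P ^ Suc n" for p
    using dedekind_mertens[OF B(1) BT xT, of n ?M p \<beta>] that unfolding n_def P_def by auto
  then show "hcomp x \<beta> \<in> star_a star E"
    by (intro star_aI[OF sub Q'(1,3,2) finite_set_power[OF P(1)] Pn]) (simp add: mult.commute)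
qed

lemma homogeneous_preserving_star_a: "homogeneous_preserving \<Gamma> Rc (star_a star)"
  unfolding homogeneous_preserving_def
proof (intro allI impI)
  fix E assume E: "homogeneous_fractional_ideal \<Gamma> Rc E \<and> E \<noteq> {0}"
  then have sub: "fract.subspace E"
    unfolding homogeneous_fractional_ideal_def fractional_ideal_def by blast
  obtain e where e: "e \<in> E" "e \<noteq> 0" using E fract.subspace_0[OF sub] by blast
  \<comment> \<open>\<open>{e}\<close> and \<open>{1}\<close> serve as the witnesses
    \<open>Q\<close> and \<open>B\<close> for \<open>0\<close> in the closure.\<close>
  have e1: "\<not> {e} \<subseteq> {0}" "\<not> {1 :: 'b fract} \<subseteq> {0}" using e(2) by auto
  have "0 \<in> star_a star E"
    using e(1) fract.subspace_0[OF subspace_star[OF span_nonzero[OF set_times_nonzero[OF e1]]]]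
    by (intro star_aI[OF sub _ _ e1(1) _ e1(2)]) auto
  then have "additive_subgroup_of (star_a star E)"
    unfolding additive_subgroup_of_def using star_a_diff[OF sub] by blast
  from is_direct_sum_iff[OF this] star_a_homogeneous E T_subset_localization
  show "star_a star E \<subseteq> homogeneous_localization \<Gamma> Rc \<and>
    is_direct_sum (star_a star E) G (\<lambda>\<alpha>. star_a star E \<inter> C \<alpha>)" by blast
qed

end

theorem corollary1:
  fixes \<Gamma> :: "'g::ab_group_add set"
    and Rc :: "'g \<Rightarrow> 'r::idom set"
    and star :: "'r fract set \<Rightarrow> 'r fract set"
  assumes "grading_monoid \<Gamma>"
    and "graded_domain \<Gamma> Rc"
    and "semistar_operation star"
    and "homogeneous_preserving \<Gamma> Rc star"
  shows "homogeneous_preserving \<Gamma> Rc (star_a star)"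
proof -
  interpret homogeneous_preserving_semistar \<Gamma> Rc star
    by unfold_locales (use assms in auto)
  show ?thesis by (rule homogeneous_preserving_star_a)
qed

end
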